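(* Let $A \in \mathbb{R}^{m\times n}$, $B\in \mathbb{R}^{l\times n}$, and assume $B$ is injective. Then, for $1 < q \leq 2 \leq p < \infty$, $$\|A\|_{p\mapsto q;B} \leq \frac{1}{2}\min_{(v,w)\in K} \left(\|v\|_{\frac{q}{2-q}}+\|w\|_{\frac{p}{p-2}}\right) \leq \gamma_p \gamma_{q^*}\|A\|_{p\mapsto q;B},$$ where $$K := \left\{(v,w) \in \mathbb{R}^{m}\times \mathbb{R}^{l} \;\middle|\; \begin{bmatrix}\operatorname{Diag}(v) & -A\\-A^\top & B^\top\operatorname{Diag}(w)B\end{bmatrix} \succeq 0\right\},$$ and $\gamma_s = \left(\frac{2^{s/2}}{\sqrt{\pi}}\Gamma\left(\frac{s+1}{2}\right)\right)^{1/s}$ for $s\in[1,\infty)$, with $\Gamma$ the Euler Gamma function.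
   Context: $\|A\|_{p\mapsto q;B} := \max_{x\in\mathbb{R}^n,\ \|Bx\|_p\leq 1} \|Ax\|_q$, where $\|\cdot\|_p$ is the vector $p$-norm. A matrix is injective if the linear map it represents is injective. $q^*$ is the Hölder conjugate of $q$, $\frac1q+\frac1{q^*}=1$. $\operatorname{Diag}(v)$ is the diagonal matrix with the entries of $v$ on its diagonal, and $\succeq 0$ means positive semidefinite. For $q=2$ the exponent $\frac{q}{2-q}$ is read as $\infty$, and for $p=2$ the exponent $\frac{p}{p-2}$ is read as $\infty$. *)

theory Defs
  imports "HOL-Analysis.Analysis"
begin

definition pnorm :: "ereal \<Rightarrow> real^'n \<Rightarrow> real" where
  "pnorm p x = (if p = \<infinity> then infnorm x
     else (\<Sum>i\<in>UNIV. \<bar>x $ i\<bar> powr real_of_ereal p) powr (1 / real_of_ereal p))"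

text \<open>
  The norm of \<open>A\<close> from \<open>p\<close> to \<open>q\<close> relative to \<open>B\<close>. It is a maximum, and the supremum below is one
  as soon as \<open>B\<close> is injective: see \<open>pq_norm_attained\<close>.
\<close>

definition pq_norm :: "ereal \<Rightarrow> ereal \<Rightarrow> real^'n^'l \<Rightarrow> real^'n^'m \<Rightarrow> real" where
  "pq_norm p q B A = (SUP x \<in> {x. pnorm p (B *v x) \<le> 1}. pnorm q (A *v x))"

definition Diag :: "real^'n \<Rightarrow> real^'n^'n" where
  "Diag v = (\<chi> i j. if i = j then v $ i else 0)"

definition block_matrix ::
  "real^'c^'a \<Rightarrow> real^'d^'a \<Rightarrow> real^'c^'b \<Rightarrow> real^'d^'b \<Rightarrow> real^('c + 'd)^('a + 'b)" where
  "block_matrix P Q R S = (\<chi> i j.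
     case i of
       Inl a \<Rightarrow> (case j of Inl c \<Rightarrow> P $ a $ c | Inr d \<Rightarrow> Q $ a $ d)
     | Inr b \<Rightarrow> (case j of Inl c \<Rightarrow> R $ b $ c | Inr d \<Rightarrow> S $ b $ d))"

definition pos_semidef :: "real^'n^'n \<Rightarrow> bool" where
  "pos_semidef M \<longleftrightarrow> transpose M = M \<and> (\<forall>x. 0 \<le> x \<bullet> (M *v x))"

definition K_set :: "real^'n^'m \<Rightarrow> real^'n^'l \<Rightarrow> ((real^'m) \<times> (real^'l)) set" where
  "K_set A B = {(v, w). pos_semidef
     (block_matrix (Diag v) (- A) (- transpose A) (transpose B ** Diag w ** B))}"

text \<open>
  In \<^typ>\<open>ereal\<close>, division of a positive number by \<open>0\<close> gives \<open>\<infinity>\<close>; so these exponents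
  \<open>q/(2-q)\<close> and \<open>p/(p-2)\<close> are \<open>\<infinity>\<close> for \<open>q = 2\<close> and \<open>p = 2\<close>.
\<close>

definition K_objective :: "real \<Rightarrow> real \<Rightarrow> (real^'m) \<times> (real^'l) \<Rightarrow> real" where
  "K_objective p q = (\<lambda>(v, w).
     pnorm (ereal q / ereal (2 - q)) v + pnorm (ereal p / ereal (p - 2)) w)"

definition gamma_const :: "real \<Rightarrow> real" where
  "gamma_const s = (2 powr (s / 2) / sqrt pi * Gamma ((s + 1) / 2)) powr (1 / s)"

lemma exponents_at_2: "ereal 2 / ereal (2 - 2) = \<infinity>"
  by (simp add: divide_ereal_def)

lemma exponents_not_2:
  "q \<noteq> 2 \<Longrightarrow> ereal q / ereal (2 - q) = ereal (q / (2 - q))"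
  "p \<noteq> 2 \<Longrightarrow> ereal p / ereal (p - 2) = ereal (p / (p - 2))"
  by simp_all

lemma continuous_on_pnorm:
  assumes "p > 0"
  shows "continuous_on S (pnorm p :: real^'n \<Rightarrow> real)"
proof (cases p)
  case (real r)
  then have r: "r > 0" using assms by simp
  have "continuous_on S (\<lambda>x::real^'n. (\<Sum>i\<in>UNIV. \<bar>x $ i\<bar> powr r) powr (1 / r))"
    using r by (intro continuous_on_powr' continuous_intros) (auto intro: sum_nonneg)
  then show ?thesis using real by (simp add: pnorm_def[abs_def])
next
  case PInf
  then show ?thesis
    by (simp add: pnorm_def[abs_def] continuous_intros)
next
  case MInf
  then show ?thesis using assms by simp
qed

lemma component_le_pnorm:
  fixes x :: "real^'n"
  assumes "p > 0"
  shows "\<bar>x $ i\<bar> \<le> pnorm p x"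
proof (cases p)
  case (real r)
  then have r: "r > 0" using assms by simp
  have "\<bar>x $ i\<bar> = (\<bar>x $ i\<bar> powr r) powr (1 / r)"
    using r by (simp add: powr_powr)
  also have "\<dots> \<le> (\<Sum>i\<in>UNIV. \<bar>x $ i\<bar> powr r) powr (1 / r)"
    using r by (intro powr_mono2 member_le_sum) auto
  finally show ?thesis using real by (simp add: pnorm_def)
next
  case PInf
  then show ?thesis by (simp add: pnorm_def component_le_infnorm_cart)
next
  case MInf
  then show ?thesis using assms by simp
qed

lemma pq_norm_attained:
  fixes A :: "real^'n^'m" and B :: "real^'n^'l"
  assumes "inj ((*v) B)" "p > 0" "q > 0"
  shows "\<exists>x. pnorm p (B *v x) \<le> 1 \<and> pnorm q (A *v x) = pq_norm p q B A \<and>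
             (\<forall>y. pnorm p (B *v y) \<le> 1 \<longrightarrow> pnorm q (A *v y) \<le> pnorm q (A *v x))"
proof -
  let ?S = "{x. pnorm p (B *v x) \<le> 1}"
  obtain c where c: "c > 0" "\<And>x. norm x * c \<le> norm (B *v x)"
    using linear_inj_bounded_below_pos[OF matrix_vector_mul_linear assms(1)]
    by (metis mult.commute)
  have "norm x \<le> CARD('l) / c" if "x \<in> ?S" for x
  proof -
    have "norm (B *v x) \<le> (\<Sum>i\<in>UNIV. \<bar>(B *v x) $ i\<bar>)"
      by (rule norm_le_l1_cart)
    also have "\<dots> \<le> (\<Sum>i\<in>(UNIV::'l set). 1)"
      using that component_le_pnorm[OF assms(2), of "B *v x"]
      by (intro sum_mono) (auto intro: order_trans)
    finally have "norm x * c \<le> CARD('l)" using c(2)[of x] by simp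
    then show ?thesis using c(1) by (simp add: field_simps)
  qed
  then have "bounded ?S" unfolding bounded_iff by blast
  moreover have "closed ?S"
    by (intro closed_Collect_le continuous_on_const
        continuous_on_compose2[OF continuous_on_pnorm[OF assms(2), of UNIV]]
        matrix_vector_mult_linear_continuous_on) auto
  ultimately have "compact ?S" by (simp add: compact_eq_bounded_closed)
  moreover have "pnorm p (B *v 0) \<le> 1"
    using assms(2) by (cases p) (auto simp: pnorm_def infnorm_0)
  then have "?S \<noteq> {}" by blast
  moreover have "continuous_on ?S (\<lambda>x. pnorm q (A *v x))"
    by (intro continuous_on_compose2[OF continuous_on_pnorm[OF assms(3), of UNIV]]
        matrix_vector_mult_linear_continuous_on) auto
  ultimately obtain x where x: "x \<in> ?S" "\<forall>y\<in>?S. pnorm q (A *v y) \<le> pnorm q (A *v x)"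
    using continuous_attains_sup by blast
  then have "pq_norm p q B A = pnorm q (A *v x)"
    unfolding pq_norm_def by (intro cSup_eq_maximum) auto
  then show ?thesis using x by auto
qed

end

theory Submission
  imports Defs "HOL-Probability.Probability"
begin

text \<open>
  Write \<open>s\<close> for the conjugate exponent \<open>qs\<close> of \<open>q\<close>, so that \<open>s \<ge> 2\<close>. The norm of \<open>A\<close> is the maximum of
  \<open>y \<bullet> (A *v x)\<close> over \<open>y\<close> in the unit ball of the \<open>s\<close>-norm and \<open>x\<close> with \<open>B *v x\<close> in the unit ball of the
  \<open>p\<close>-norm. The exponents in the objective are the conjugates of \<open>s / 2\<close> and \<open>p / 2\<close>, so its two norms
  are dual to those that measure the vectors of squared entries of \<open>y\<close> and \<open>B *v x\<close>.

  The lower bound is weak duality: a pair \<open>(v, w)\<close> in \<open>K_set A B\<close> bounds \<open>2 * (y \<bullet> (A *v x))\<close> by two weighted sums of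
  squares, and Hoelder's inequality bounds those by the norms of \<open>v\<close> and \<open>w\<close>
  (\<open>pq_norm_le_dual_objective\<close>).

  The upper bound holds because the semidefinite relaxation can be rounded. Let \<open>c\<close> be the norm of \<open>A\<close>
  times the two Gaussian constants. If no pair of weights of norms at most \<open>c\<close> were in \<open>K_set A B\<close>, a
  hyperplane would separate the corresponding compact convex set of matrices from the cone of
  positive semidefinite matrices (\<open>separate_from_pos_semidef\<close>). Its normal is a positive semidefinite
  matrix, that is, a solution of the relaxed maximisation problem with too large a value. A Gaussian
  vector \<open>(y, x)\<close> with this covariance matrix has the value of the relaxation as expectation of
  \<open>y \<bullet> (A *v x)\<close>, while the moments of the norms of \<open>y\<close> and \<open>B *v x\<close> exceed what the relaxation allows
  only by the Gaussian constants. Hence the value is at most what the norm of \<open>A\<close> permits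
  (\<open>gaussian_rounding\<close>), a contradiction. Thus \<open>K_set A B\<close> contains a pair with objective at most \<open>2 * c\<close>
  (\<open>exists_small_dual_feasible\<close>), and since the sublevel sets of the objective in \<open>K_set A B\<close> are compact, the
  minimum is attained.
\<close>

section \<open>Conjugate exponents and the vector norms\<close>

text \<open>
  The Hoelder conjugate of \<open>s \<ge> 1\<close>; division in \<^typ>\<open>ereal\<close> gives the value \<open>\<infinity>\<close> at \<open>s = 1\<close>.
\<close>

definition conjugate :: "real \<Rightarrow> ereal" where
  "conjugate s = ereal s / ereal (s - 1)"

lemma conjugate_1: "conjugate 1 = \<infinity>"
  by (simp add: conjugate_def divide_ereal_def)

lemma conjugate_gt_1: "s > 1 \<Longrightarrow> conjugate s = ereal (s / (s - 1))"
  by (simp add: conjugate_def)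

lemma conjugate_pos: "s \<ge> 1 \<Longrightarrow> conjugate s > 0"
  by (cases "s = 1") (auto simp: conjugate_1 conjugate_gt_1)

lemma pnorm_ereal: "pnorm (ereal r) x = (\<Sum>i\<in>UNIV. \<bar>x $ i\<bar> powr r) powr (1 / r)"
  by (simp add: pnorm_def)

lemma pnorm_nonneg: "pnorm r x \<ge> 0"
  by (simp add: pnorm_def infnorm_pos_le)

lemma pnorm_powr: "r > 0 \<Longrightarrow> pnorm (ereal r) x powr r = (\<Sum>i\<in>UNIV. \<bar>x $ i\<bar> powr r)"
  by (simp add: pnorm_ereal powr_powr sum_nonneg)

lemma pnorm_eq_0:
  assumes "r > 0" "pnorm r x = 0"
  shows "x = 0"
  using component_le_pnorm[OF assms(1), of x] assms(2) by (simp add: vec_eq_iff)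

lemma pnorm_scaleR:
  assumes "r > 0"
  shows "pnorm r (c *\<^sub>R x) = \<bar>c\<bar> * pnorm r x"
proof (cases r)
  case (real t)
  then have "t > 0" using assms by simp
  then show ?thesis
    by (simp add: real pnorm_ereal abs_mult powr_mult powr_powr sum_nonneg flip: sum_distrib_left)
next
  case PInf
  then show ?thesis by (simp add: pnorm_def infnorm_mul)
qed (use assms in simp)

lemma pnorm_le_iff:
  assumes "r > 0" "c \<ge> 0"
  shows "pnorm (ereal r) x \<le> c \<longleftrightarrow> (\<Sum>i\<in>UNIV. \<bar>x $ i\<bar> powr r) \<le> c powr r"
proof -
  have "pnorm (ereal r) x \<le> c \<longleftrightarrow> pnorm (ereal r) x powr r \<le> c powr r"
    using assms pnorm_nonneg[of "ereal r" x]
    by (meson less_imp_le not_le powr_less_mono2 powr_mono2)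
  then show ?thesis using assms by (simp add: pnorm_powr)
qed

text \<open>
  Convexity of a power on the open half-line extends to the whole line: the origin is handled by
  \<open>t powr r \<le> t\<close> on the unit interval, negative arguments by the triangle inequality.
\<close>

lemma abs_powr_convex:
  fixes x y :: real
  assumes "r \<ge> 1" "u \<ge> 0" "v \<ge> 0" "u + v = 1"
  shows "\<bar>u * x + v * y\<bar> powr r \<le> u * \<bar>x\<bar> powr r + v * \<bar>y\<bar> powr r"
proof -
  have *: "(u * a + v * b) powr r \<le> u * a powr r + v * b powr r" if "a \<ge> 0" "b \<ge> 0" for a b
  proof (cases "a = 0 \<or> b = 0")
    case True
    have "t powr r \<le> t" if "0 \<le> t" "t \<le> 1" for t :: real
      using that assms powr_mono'[of 1 r t] by (cases "t = 0") auto
    then have "(u * a + v * b) powr r \<le> u * a powr r \<or> (u * a + v * b) powr r \<le> v * b powr r"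
      using True assms that by (auto simp: powr_mult intro!: mult_right_mono)
    then show ?thesis using assms by (smt (verit) mult_nonneg_nonneg powr_ge_zero)
  next
    case False
    have "u = 1 - v" using assms by simp
    then show ?thesis
      using convex_onD[OF powr_convex[OF assms(1)], of v a b] that assms False
      by (simp add: \<open>u = 1 - v\<close>)
  qed
  have "\<bar>u * x + v * y\<bar> \<le> u * \<bar>x\<bar> + v * \<bar>y\<bar>"
    using assms abs_triangle_ineq[of "u * x" "v * y"] by (simp add: abs_mult)
  then have "\<bar>u * x + v * y\<bar> powr r \<le> (u * \<bar>x\<bar> + v * \<bar>y\<bar>) powr r"
    using assms by (intro powr_mono2) auto
  also have "\<dots> \<le> u * \<bar>x\<bar> powr r + v * \<bar>y\<bar> powr r" by (rule *) auto
  finally show ?thesis .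
qed

text \<open>
  For finite \<open>r\<close> the ball is a sublevel set of the \<open>r\<close>-th power of the norm, a sum of convex functions of
  the coordinates.
\<close>

lemma convex_pnorm_ball:
  assumes "r \<ge> 1" "c \<ge> 0"
  shows "convex {x :: real^'n. pnorm r x \<le> c}"
proof (cases r)
  case (real t)
  then have t: "t \<ge> 1" using assms by simp
  have "pnorm r (u *\<^sub>R x + v *\<^sub>R y) \<le> c"
    if "pnorm r x \<le> c" "pnorm r y \<le> c" "u \<ge> 0" "v \<ge> 0" "u + v = 1" for x y :: "real^'n" and u v
  proof -
    have "(\<Sum>i\<in>UNIV. \<bar>(u *\<^sub>R x + v *\<^sub>R y) $ i\<bar> powr t)
        \<le> (\<Sum>i\<in>UNIV. u * \<bar>x $ i\<bar> powr t + v * \<bar>y $ i\<bar> powr t)"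
      using that t by (intro sum_mono) (simp add: abs_powr_convex)
    also have "\<dots> = u * (\<Sum>i\<in>UNIV. \<bar>x $ i\<bar> powr t) + v * (\<Sum>i\<in>UNIV. \<bar>y $ i\<bar> powr t)"
      by (simp add: sum.distrib sum_distrib_left)
    also have "\<dots> \<le> u * c powr t + v * c powr t"
      using that t assms(2) by (intro add_mono mult_left_mono) (auto simp: real pnorm_le_iff)
    also have "\<dots> = c powr t" using that by (simp flip: distrib_right)
    finally show ?thesis using t assms(2) by (simp add: real pnorm_le_iff)
  qed
  then show ?thesis by (auto simp: convex_def)
next
  case PInf
  have "infnorm (u *\<^sub>R x + v *\<^sub>R y) \<le> c"
    if "infnorm x \<le> c" "infnorm y \<le> c" "u \<ge> 0" "v \<ge> 0" "u + v = 1" for x y :: "real^'n" and u v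
  proof -
    have "infnorm (u *\<^sub>R x + v *\<^sub>R y) \<le> u * infnorm x + v * infnorm y"
      using infnorm_triangle[of "u *\<^sub>R x" "v *\<^sub>R y"] that by (simp add: infnorm_mul)
    also have "\<dots> \<le> c" using that by (intro convex_bound_le) auto
    finally show ?thesis .
  qed
  then show ?thesis by (auto simp: convex_def PInf pnorm_def)
qed (use assms in simp)

lemma compact_pnorm_ball:
  assumes "r > 0"
  shows "compact {x :: real^'n. pnorm r x \<le> c}"
proof -
  have "norm x \<le> CARD('n) * c" if "pnorm r x \<le> c" for x :: "real^'n"
  proof -
    have "norm x \<le> (\<Sum>i\<in>UNIV. \<bar>x $ i\<bar>)" by (rule norm_le_l1_cart)
    also have "\<dots> \<le> (\<Sum>i\<in>(UNIV::'n set). c)"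
      using that component_le_pnorm[OF assms, of x] by (intro sum_mono) (auto intro: order_trans)
    finally show ?thesis by simp
  qed
  then have "bounded {x :: real^'n. pnorm r x \<le> c}" unfolding bounded_iff by blast
  moreover have "closed {x :: real^'n. pnorm r x \<le> c}"
    by (intro closed_Collect_le continuous_on_const continuous_on_pnorm assms)
  ultimately show ?thesis by (simp add: compact_eq_bounded_closed)
qed

text \<open>
  After normalising both vectors, this is Young's inequality in each coordinate. For \<open>s = 1\<close> the
  conjugate norm is the maximum norm, which bounds each coordinate.
\<close>

lemma Hoelder_sum:
  fixes v \<alpha> :: "real^'n"
  assumes s: "s \<ge> 1"
  shows "(\<Sum>i\<in>UNIV. v $ i * \<alpha> $ i) \<le> pnorm (conjugate s) v * pnorm (ereal s) \<alpha>"
proof (cases "s = 1")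
  case True
  have "v $ i * \<alpha> $ i \<le> pnorm \<infinity> v * \<bar>\<alpha> $ i\<bar>" for i
  proof -
    have "v $ i * \<alpha> $ i \<le> \<bar>v $ i\<bar> * \<bar>\<alpha> $ i\<bar>" by (metis abs_ge_self abs_mult)
    also have "\<dots> \<le> pnorm \<infinity> v * \<bar>\<alpha> $ i\<bar>"
      by (intro mult_right_mono component_le_pnorm) auto
    finally show ?thesis .
  qed
  then have "(\<Sum>i\<in>UNIV. v $ i * \<alpha> $ i) \<le> (\<Sum>i\<in>UNIV. pnorm \<infinity> v * \<bar>\<alpha> $ i\<bar>)"
    by (intro sum_mono)
  also have "\<dots> = pnorm \<infinity> v * pnorm (ereal 1) \<alpha>"
    by (simp add: pnorm_ereal sum_nonneg flip: sum_distrib_left)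
  finally show ?thesis using True by (simp add: conjugate_1)
next
  case False
  define t where "t = s / (s - 1)"
  have st: "s > 1" "t > 1" "1 / t + 1 / s = 1"
    using False s by (auto simp: t_def field_simps)
  have ct: "conjugate s = ereal t" using st(1) by (simp add: conjugate_gt_1 t_def)
  define V where "V = pnorm (ereal t) v"
  define W where "W = pnorm (ereal s) \<alpha>"
  show ?thesis
  proof (cases "V = 0 \<or> W = 0")
    case True
    then have "v = 0 \<or> \<alpha> = 0"
      using pnorm_eq_0[of "ereal t" v] pnorm_eq_0[of "ereal s" \<alpha>] st by (auto simp: V_def W_def)
    then show ?thesis using pnorm_nonneg by (auto intro!: mult_nonneg_nonneg)
  next
    case False
    then have pos: "V > 0" "W > 0"
      using pnorm_nonneg[of "ereal t" v] pnorm_nonneg[of "ereal s" \<alpha>] by (auto simp: V_def W_def)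
    have "v $ i * \<alpha> $ i / (V * W) \<le> \<bar>v $ i\<bar> powr t / V powr t / t + \<bar>\<alpha> $ i\<bar> powr s / W powr s / s" for i
    proof -
      have "v $ i * \<alpha> $ i / (V * W) \<le> (\<bar>v $ i\<bar> / V) * (\<bar>\<alpha> $ i\<bar> / W)"
        using pos by (simp add: divide_right_mono flip: abs_mult)
      also have "\<dots> \<le> (\<bar>v $ i\<bar> / V) powr t / t + (\<bar>\<alpha> $ i\<bar> / W) powr s / s"
        using st pos by (intro Youngs_inequality) auto
      finally show ?thesis using pos by (simp add: powr_divide)
    qed
    then have "(\<Sum>i\<in>UNIV. v $ i * \<alpha> $ i / (V * W))
        \<le> (\<Sum>i\<in>UNIV. \<bar>v $ i\<bar> powr t / V powr t / t + \<bar>\<alpha> $ i\<bar> powr s / W powr s / s)"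
      by (rule sum_mono)
    also have "\<dots> = (\<Sum>i\<in>UNIV. \<bar>v $ i\<bar> powr t) / V powr t / t + (\<Sum>i\<in>UNIV. \<bar>\<alpha> $ i\<bar> powr s) / W powr s / s"
      by (simp add: sum.distrib sum_divide_distrib)
    also have "\<dots> = V powr t / V powr t / t + W powr s / W powr s / s"
      using st by (simp add: V_def W_def pnorm_powr)
    also have "\<dots> = 1 / t + 1 / s"
      using pos by simp
    finally have "(\<Sum>i\<in>UNIV. v $ i * \<alpha> $ i) / (V * W) \<le> 1"
      using st by (simp add: sum_divide_distrib)
    then show ?thesis using pos by (simp add: ct V_def[symmetric] W_def[symmetric])
  qed
qed

text \<open>
  The extremal vector is the constant \<open>1\<close> for \<open>s = 1\<close>, and otherwise proportional to the power
  \<open>s - 1\<close> of the given one; for \<open>s > 1\<close> equality in Young's inequality forces this choice.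
\<close>

lemma Hoelder_sum_attained:
  fixes \<alpha> :: "real^'n"
  assumes s: "s \<ge> 1" and nonneg: "\<And>i. \<alpha> $ i \<ge> 0"
  shows "\<exists>v :: real^'n. pnorm (conjugate s) v \<le> 1 \<and> (\<Sum>i\<in>UNIV. v $ i * \<alpha> $ i) = pnorm (ereal s) \<alpha>"
proof (cases "s = 1")
  case True
  have "infnorm (\<chi> i. 1 :: real^'n) \<le> 1"
    by (simp add: infnorm_cart cSup_le_iff)
  then have "pnorm (conjugate s) (\<chi> i. 1 :: real^'n) \<le> 1" using True by (simp add: conjugate_1 pnorm_def)
  moreover have "(\<Sum>i\<in>UNIV. (\<chi> i. 1) $ i * \<alpha> $ i) = pnorm (ereal s) \<alpha>"
    using True nonneg by (simp add: pnorm_ereal sum_nonneg)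
  ultimately show ?thesis by blast
next
  case False
  define t where "t = s / (s - 1)"
  have st: "s > 1" "t > 1" "t * (s - 1) = s"
    using False s by (auto simp: t_def field_simps)
  have ct: "conjugate s = ereal t" using st(1) by (simp add: conjugate_gt_1 t_def)
  define W where "W = pnorm (ereal s) \<alpha>"
  define v where "v = (\<chi> i. \<alpha> $ i powr (s - 1) / W powr (s - 1))"
  show ?thesis
  proof (cases "W = 0")
    case True
    then have "pnorm (conjugate s) (0 :: real^'n) \<le> 1 \<and>
        (\<Sum>i\<in>UNIV. (0 :: real^'n) $ i * \<alpha> $ i) = pnorm (ereal s) \<alpha>"
      using st by (simp add: ct pnorm_ereal W_def)
    then show ?thesis by blast
  next
    case False
    then have W: "W > 0" using pnorm_nonneg[of "ereal s" \<alpha>] by (simp add: W_def)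
    have sum: "(\<Sum>i\<in>UNIV. \<alpha> $ i powr s) = W powr s"
      using pnorm_powr[of s \<alpha>] st nonneg by (simp add: W_def)
    have "(\<Sum>i\<in>UNIV. \<bar>v $ i\<bar> powr t) = (\<Sum>i\<in>UNIV. \<alpha> $ i powr s / W powr s)"
      using W st nonneg by (intro sum.cong) (auto simp: v_def powr_divide powr_powr mult.commute)
    also have "\<dots> = 1" using W by (simp add: sum flip: sum_divide_distrib)
    finally have ball: "pnorm (conjugate s) v \<le> 1" by (simp add: ct pnorm_ereal)
    have "v $ i * \<alpha> $ i = \<alpha> $ i powr s / W powr (s - 1)" for i
      using nonneg[of i] st powr_mult_base[of "\<alpha> $ i" "s - 1"]
      by (auto simp: v_def mult.commute)
    then have "(\<Sum>i\<in>UNIV. v $ i * \<alpha> $ i) = W powr s / W powr (s - 1)"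
      by (simp add: sum flip: sum_divide_distrib)
    also have "\<dots> = W" using W by (simp flip: powr_diff)
    finally have "(\<Sum>i\<in>UNIV. v $ i * \<alpha> $ i) = pnorm (ereal s) \<alpha>" by (simp add: W_def)
    with ball show ?thesis by blast
  qed
qed

section \<open>Positive semidefinite matrices\<close>

definition outer :: "real^'n \<Rightarrow> real^'n^'n" where
  "outer z = (\<chi> i j. z $ i * z $ j)"

lemma outer_nth [simp]: "outer z $ i $ j = z $ i * z $ j"
  by (simp add: outer_def)

lemma inner_matrix: "(A :: real^'n^'m) \<bullet> B = (\<Sum>i\<in>UNIV. \<Sum>j\<in>UNIV. A $ i $ j * B $ i $ j)"
  by (simp add: inner_vec_def)

text \<open>
  The pairing of matrices in this file is the inner product of \<^typ>\<open>real^'n^'n\<close>, that is, the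
  trace pairing; with it a quadratic form becomes a linear functional of the matrix.
\<close>

lemma quadratic_form_sum:
  "x \<bullet> ((M :: real^'n^'n) *v x) = (\<Sum>i\<in>UNIV. \<Sum>j\<in>UNIV. M $ i $ j * (x $ i * x $ j))"
  by (simp add: inner_vec_def matrix_vector_mult_def sum_distrib_left mult_ac)

lemma inner_outer: "M \<bullet> outer z = z \<bullet> (M *v z)"
  by (simp add: inner_matrix quadratic_form_sum)

lemma quadratic_form_outer: "x \<bullet> (outer z *v x) = (z \<bullet> x)\<^sup>2"
  unfolding quadratic_form_sum by (simp add: inner_vec_def power2_eq_square sum_product mult_ac)

lemma pos_semidef_outer: "pos_semidef (outer z)"
  by (simp add: pos_semidef_def quadratic_form_outer transpose_def vec_eq_iff mult.commute)

lemma pos_semidef_scaleR: "pos_semidef M \<Longrightarrow> c \<ge> 0 \<Longrightarrow> pos_semidef (c *\<^sub>R M)"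
  by (simp add: pos_semidef_def transpose_def vec_eq_iff flip: scaleR_matrix_vector_assoc)

lemma pos_semidef_add: "pos_semidef M \<Longrightarrow> pos_semidef N \<Longrightarrow> pos_semidef (M + N)"
  by (simp add: pos_semidef_def transpose_def vec_eq_iff matrix_vector_mult_add_rdistrib inner_add_right)

lemma convex_pos_semidef: "convex {M. pos_semidef M}"
  by (auto simp: convex_def intro!: pos_semidef_add pos_semidef_scaleR)

lemma closed_pos_semidef: "closed {M :: real^'n^'n. pos_semidef M}"
  unfolding pos_semidef_def transpose_def matrix_vector_mult_def inner_vec_def
  by (intro closed_Collect_conj closed_Collect_eq closed_Collect_all closed_Collect_le continuous_intros)

lemma pos_semidef_sym: "pos_semidef M \<Longrightarrow> M $ i $ j = M $ j $ i"
  unfolding pos_semidef_def transpose_def by (metis vec_lambda_beta)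

lemma pos_semidef_diag_nonneg:
  assumes "pos_semidef M"
  shows "M $ i $ i \<ge> 0"
proof -
  have "axis i 1 \<bullet> (M *v axis i 1) = M $ i $ i"
    by (simp add: inner_axis' matrix_vector_mul_component inner_axis)
  then show ?thesis using assms unfolding pos_semidef_def by metis
qed

text \<open>
  Evaluate the form at the sum and at the difference of two basis vectors: without the diagonal,
  only the off-diagonal entry is left, once with each sign.
\<close>

lemma pos_semidef_diag_eq_0:
  fixes M :: "real^'n^'n"
  assumes M: "pos_semidef M" and 0: "\<And>i. M $ i $ i = 0"
  shows "M = 0"
proof -
  have "M $ i $ j = 0" for i j
  proof -
    have *: "(axis i 1 + t *\<^sub>R axis j 1) \<bullet> (M *v (axis i 1 + t *\<^sub>R axis j 1)) = 2 * t * M $ i $ j" for t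
      using pos_semidef_sym[OF M, of j i] 0
      by (simp add: matrix_vector_right_distrib matrix_vector_mult_scaleR inner_add_left
          inner_add_right inner_axis' inner_axis matrix_vector_mul_component)
    have "0 \<le> 2 * 1 * M $ i $ j" "0 \<le> 2 * (-1) * M $ i $ j"
      unfolding *[symmetric] using M unfolding pos_semidef_def by blast+
    then show ?thesis by simp
  qed
  then show ?thesis by (simp add: vec_eq_iff)
qed

text \<open>
  The form of the Schur complement at \<open>x\<close> is the minimum of the form of \<open>M\<close> over the line through
  \<open>x\<close> in the direction of the \<open>k\<close>-th basis vector, hence nonnegative.
\<close>

lemma pos_semidef_schur_complement:
  fixes M :: "real^'n^'n"
  assumes M: "pos_semidef M" and d: "M $ k $ k > 0"
  shows "pos_semidef (M - outer ((1 / sqrt (M $ k $ k)) *\<^sub>R M $ k))"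
proof -
  define d where "d = M $ k $ k"
  have d: "d > 0" using d by (simp add: d_def)
  have "0 \<le> x \<bullet> ((M - outer ((1 / sqrt d) *\<^sub>R M $ k)) *v x)" for x
  proof -
    \<comment> \<open>the minimiser on that line is \<open>x - t *\<^sub>R axis k 1\<close>\<close>
    define t where "t = (M $ k \<bullet> x) / d"
    have *: "axis k 1 \<bullet> (M *v x) = t * d" "axis k 1 \<bullet> (M *v axis k 1) = d"
      using d by (simp_all add: inner_axis' inner_axis matrix_vector_mul_component t_def d_def)
    have "x \<bullet> (M *v axis k 1) = axis k 1 \<bullet> (M *v x)"
      using M by (metis dot_lmul_matrix inner_commute pos_semidef_def vector_transpose_matrix)
    then have "0 \<le> x \<bullet> (M *v x) - t * (t * d) - t * (t * d) + t * (t * d)"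
      using M[unfolded pos_semidef_def, THEN conjunct2, rule_format, of "x - t *\<^sub>R axis k 1"] *
      by (simp add: matrix_vector_mult_diff_distrib matrix_vector_mult_scaleR inner_diff_left
          inner_diff_right algebra_simps)
    moreover have "x \<bullet> (outer ((1 / sqrt d) *\<^sub>R M $ k) *v x) = t * (t * d)"
      using d by (simp add: quadratic_form_outer t_def power_divide power2_eq_square)
    ultimately show ?thesis
      by (simp add: matrix_vector_mult_diff_rdistrib inner_diff_right mult_ac)
  qed
  moreover have "transpose (M - outer ((1 / sqrt d) *\<^sub>R M $ k)) = M - outer ((1 / sqrt d) *\<^sub>R M $ k)"
    using pos_semidef_sym[OF M] by (simp add: transpose_def vec_eq_iff)
  ultimately show ?thesis by (simp add: pos_semidef_def d_def)
qed

text \<open>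
  Cholesky elimination, as an induction over a set that contains the support of the diagonal.
  Subtracting the rank one matrix of the pivot \<open>k\<close> leaves a positive semidefinite matrix with a zero at
  that diagonal place. A diagonal entry that was zero can only drop under this subtraction, and
  positive semidefiniteness forbids it to become negative, so it stays zero.
\<close>

text \<open>
  This factorisation takes the place of a matrix square root: a Gaussian combination of the vectors
  \<open>c k\<close> has \<open>M\<close> as its covariance matrix.
\<close>

lemma pos_semidef_sum_outer_on:
  assumes "finite F"
  shows "pos_semidef (M :: real^'n^'n) \<Longrightarrow> (\<And>i. i \<notin> F \<Longrightarrow> M $ i $ i = 0) \<Longrightarrow>
    \<exists>c. M = (\<Sum>k\<in>F. outer (c k))"
  using assms
proof (induction F arbitrary: M rule: finite_induct)
  case empty
  then show ?case using pos_semidef_diag_eq_0[of M] by simp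
next
  case (insert k F)
  define u where "u = (1 / sqrt (M $ k $ k)) *\<^sub>R M $ k"
  have "\<exists>z c. M = outer z + (\<Sum>j\<in>F. outer (c j))"
  proof (cases "M $ k $ k = 0")
    case True
    then have "\<exists>c. M = (\<Sum>j\<in>F. outer (c j))"
      using insert.prems by (intro insert.IH) (auto, metis)
    moreover have "outer (0 :: real^'n) = 0" by (simp add: vec_eq_iff)
    ultimately show ?thesis by (metis add_0)
  next
    case False
    then have d: "M $ k $ k > 0" using pos_semidef_diag_nonneg[OF insert.prems(1), of k] by simp
    have S: "pos_semidef (M - outer u)"
      unfolding u_def by (rule pos_semidef_schur_complement[OF insert.prems(1) d])
    have "\<exists>c. M - outer u = (\<Sum>j\<in>F. outer (c j))"
    proof (rule insert.IH[OF S])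
      fix i assume i: "i \<notin> F"
      show "(M - outer u) $ i $ i = 0"
      proof (cases "i = k")
        case True
        then show ?thesis using d by (simp add: u_def)
      next
        case False
        then have "M $ i $ i = 0" using i insert.prems(2) by simp
        then show ?thesis using pos_semidef_diag_nonneg[OF S, of i] by (auto simp: mult_le_0_iff)
      qed
    qed
    then show ?thesis by (metis add.commute diff_add_cancel)
  qed
  then obtain z c where "M = outer z + (\<Sum>j\<in>F. outer (c j))" by blast
  moreover have "(\<Sum>j\<in>F. outer ((c(k := z)) j)) = (\<Sum>j\<in>F. outer (c j))"
    using insert.hyps by (intro sum.cong) auto
  ultimately have "M = (\<Sum>j\<in>insert k F. outer ((c(k := z)) j))"
    using insert.hyps by simp
  then show ?case by blast
qed

lemma pos_semidef_sum_outer: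
  assumes "pos_semidef (M :: real^'n^'n)"
  shows "\<exists>c :: 'n \<Rightarrow> real^'n. M = (\<Sum>k\<in>UNIV. outer (c k))"
  by (rule pos_semidef_sum_outer_on) (use assms in auto)

lemma congruence_Diag_nth:
  "(transpose B ** Diag w ** (B :: real^'n^'l)) $ i $ j = (\<Sum>l\<in>UNIV. w $ l * (B $ l $ i * B $ l $ j))"
proof -
  have "(transpose B ** Diag w) $ i $ l = w $ l * B $ l $ i" for l
    by (simp add: matrix_matrix_mult_def transpose_def Diag_def if_distrib cong: if_cong)
  then show ?thesis
    by (simp add: matrix_matrix_mult_def[of "transpose B ** Diag w"] mult.assoc)
qed

definition K_matrix :: "real^'n^'m \<Rightarrow> real^'n^'l \<Rightarrow> real^'m \<Rightarrow> real^'l \<Rightarrow> real^('m + 'n)^('m + 'n)" where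
  "K_matrix A B v w = block_matrix (Diag v) (- A) (- transpose A) (transpose B ** Diag w ** B)"

lemma K_matrix_nth:
  "K_matrix A B v w $ Inl i $ Inl i' = (if i = i' then v $ i else 0)"
  "K_matrix A B v w $ Inl i $ Inr j = - A $ i $ j"
  "K_matrix A B v w $ Inr j $ Inl i = - A $ i $ j"
  "K_matrix A B v w $ Inr j $ Inr j' = (\<Sum>l\<in>UNIV. w $ l * (B $ l $ j * B $ l $ j'))"
  by (simp_all add: K_matrix_def block_matrix_def congruence_Diag_nth)
    (simp_all add: Diag_def transpose_def)

lemma in_K_set: "(v, w) \<in> K_set A B \<longleftrightarrow> pos_semidef (K_matrix A B v w)"
  by (simp add: K_set_def K_matrix_def)

lemma sum_UNIV_Plus:
  "(\<Sum>x\<in>(UNIV :: ('a::finite + 'b::finite) set). f x) = (\<Sum>a\<in>UNIV. f (Inl a)) + (\<Sum>b\<in>UNIV. f (Inr b))"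
  by (simp add: sum.Plus flip: UNIV_Plus_UNIV)

lemma all_Plus: "(\<forall>x :: 'a + 'b. P x) \<longleftrightarrow> (\<forall>a. P (Inl a)) \<and> (\<forall>b. P (Inr b))"
  by (metis sum.exhaust)

lemma transpose_K_matrix: "transpose (K_matrix A B v w) = K_matrix A B v w"
  by (auto simp: transpose_def vec_eq_iff all_Plus K_matrix_nth mult_ac)

text \<open>
  Both inequalities of the theorem rest on this expansion: nonnegativity of the form bounds
  \<open>y \<bullet> (A *v x)\<close> by the two weighted sums of squares.
\<close>

lemma quadratic_form_K_matrix:
  fixes A :: "real^'n^'m" and B :: "real^'n^'l"
  defines "y \<equiv> \<lambda>z. (\<chi> i. z $ Inl i) :: real^'m" and "x \<equiv> \<lambda>z. (\<chi> j. z $ Inr j) :: real^'n"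
  shows "z \<bullet> (K_matrix A B v w *v z)
    = (\<Sum>i\<in>UNIV. v $ i * (y z $ i)\<^sup>2) - 2 * (y z \<bullet> (A *v x z)) + (\<Sum>l\<in>UNIV. w $ l * ((B *v x z) $ l)\<^sup>2)"
proof -
  have 1: "(\<Sum>i\<in>UNIV. \<Sum>i'\<in>UNIV. K_matrix A B v w $ Inl i $ Inl i' * (z $ Inl i * z $ Inl i'))
      = (\<Sum>i\<in>UNIV. v $ i * (y z $ i)\<^sup>2)"
    by (simp add: K_matrix_nth y_def power2_eq_square if_distrib[of "\<lambda>t. t * _"] cong: if_cong)
  have 2: "(\<Sum>i\<in>UNIV. \<Sum>j\<in>UNIV. K_matrix A B v w $ Inl i $ Inr j * (z $ Inl i * z $ Inr j))
      = - (y z \<bullet> (A *v x z))"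
    by (simp add: K_matrix_nth y_def x_def inner_vec_def matrix_vector_mult_def sum_distrib_left
        sum_negf mult_ac)
  have 3: "(\<Sum>j\<in>UNIV. \<Sum>i\<in>UNIV. K_matrix A B v w $ Inr j $ Inl i * (z $ Inr j * z $ Inl i))
      = - (y z \<bullet> (A *v x z))"
    unfolding 2[symmetric] by (subst sum.swap) (simp add: K_matrix_nth mult_ac)
  have "(\<Sum>j\<in>UNIV. \<Sum>j'\<in>UNIV. K_matrix A B v w $ Inr j $ Inr j' * (z $ Inr j * z $ Inr j'))
      = (\<Sum>j\<in>UNIV. \<Sum>j'\<in>UNIV. \<Sum>l\<in>UNIV. w $ l * (B $ l $ j * z $ Inr j) * (B $ l $ j' * z $ Inr j'))"
    by (simp add: K_matrix_nth sum_distrib_left sum_distrib_right mult_ac)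
  also have "\<dots> = (\<Sum>j\<in>UNIV. \<Sum>l\<in>UNIV. \<Sum>j'\<in>UNIV. w $ l * (B $ l $ j * z $ Inr j) * (B $ l $ j' * z $ Inr j'))"
    by (intro sum.cong sum.swap refl)
  also have "\<dots> = (\<Sum>l\<in>UNIV. \<Sum>j\<in>UNIV. \<Sum>j'\<in>UNIV. w $ l * (B $ l $ j * z $ Inr j) * (B $ l $ j' * z $ Inr j'))"
    by (rule sum.swap)
  also have "\<dots> = (\<Sum>l\<in>UNIV. w $ l * ((B *v x z) $ l)\<^sup>2)"
    by (simp add: matrix_vector_mult_def x_def power2_eq_square sum_product)
      (simp add: sum_distrib_left mult_ac)
  finally have 4: "(\<Sum>j\<in>UNIV. \<Sum>j'\<in>UNIV. K_matrix A B v w $ Inr j $ Inr j' * (z $ Inr j * z $ Inr j'))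
      = (\<Sum>l\<in>UNIV. w $ l * ((B *v x z) $ l)\<^sup>2)" .
  show ?thesis
    unfolding quadratic_form_sum sum_UNIV_Plus sum.distrib 1 2 3 4 by simp
qed

text \<open>
  \<^const>\<open>K_matrix\<close> is affine, not linear, in the weights: the block \<open>A\<close> is fixed, which is why the
  coefficients have to add up to \<open>1\<close>.
\<close>

lemma K_matrix_convex_combination:
  assumes "s + t = 1"
  shows "K_matrix A B (s *\<^sub>R v + t *\<^sub>R v') (s *\<^sub>R w + t *\<^sub>R w')
    = s *\<^sub>R K_matrix A B v w + t *\<^sub>R K_matrix A B v' w'"
proof -
  have "A $ i $ j = s * A $ i $ j + t * A $ i $ j" for i j
    using assms by (simp flip: distrib_right)
  then show ?thesis
    by (auto simp: vec_eq_iff all_Plus K_matrix_nth sum_distrib_left sum.distrib algebra_simps)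
qed

lemma continuous_on_K_matrix: "continuous_on S (\<lambda>(v, w). K_matrix A B v w)"
proof -
  have "continuous_on S (\<lambda>z. K_matrix A B (fst z) (snd z) $ i $ j)" for i j
  proof (cases "\<exists>a a'. i = Inl a \<and> j = Inl a'")
    case True
    then obtain a a' where "i = Inl a" "j = Inl a'" by blast
    then show ?thesis by (cases "a = a'") (auto simp: K_matrix_nth intro!: continuous_intros)
  next
    case False
    then show ?thesis by (cases i; cases j) (auto simp: K_matrix_nth intro!: continuous_intros)
  qed
  then have "continuous_on S (\<lambda>z. \<chi> i j. K_matrix A B (fst z) (snd z) $ i $ j)"
    by (intro continuous_on_vec_lambda)
  then show ?thesis by (simp add: case_prod_beta)
qed

section \<open>Standard Gaussian vectors\<close>

lemma gamma_const_powr: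
  assumes "s > 0"
  shows "gamma_const s powr s = 2 powr (s / 2) / sqrt pi * Gamma ((s + 1) / 2)"
proof -
  have "Gamma ((s + 1) / 2) > 0" using assms by (intro Gamma_real_pos) auto
  then show ?thesis
    unfolding gamma_const_def using assms by (simp add: powr_powr)
qed

lemma gamma_const_pos:
  assumes "s > 0"
  shows "gamma_const s > 0"
proof -
  have "Gamma ((s + 1) / 2) > 0" using assms by (intro Gamma_real_pos) auto
  then show ?thesis
    unfolding gamma_const_def by simp
qed

text \<open>
  A standard normal variable has variance \<open>1\<close>, so second moments carry no constant.
\<close>

lemma gamma_const_2: "gamma_const 2 = 1"
proof -
  have *: "Gamma (3/2 :: real) = sqrt pi / 2"
    using Gamma_plus1[of "1/2::real"] nonpos_Ints_nonpos[of "1/2::real"]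
    by (auto simp: Gamma_one_half_real)
  show ?thesis by (simp add: gamma_const_def *)
qed

text \<open>
  Here \<^const>\<open>gamma_const\<close> gets its meaning: it is the norm of a standard normal variable in the space
  \<open>L\<^sup>s\<close>. The substitution \<open>t = x\<^sup>2 / 2\<close> turns half of the moment integral into the Gamma
  integral at \<open>(s + 1) / 2\<close>, and symmetry supplies the other half.
\<close>

lemma std_normal_absolute_moment:
  assumes s: "s > 0"
  shows "has_bochner_integral lborel (\<lambda>x. std_normal_density x * \<bar>x\<bar> powr s) (gamma_const s powr s)"
proof -
  define f where "f = (\<lambda>t::real. t powr ((s + 1) / 2 - 1) / exp t)"
  define g where "g = (\<lambda>x::real. x\<^sup>2 / 2)"
  let ?h = "\<lambda>x::real. \<bar>x\<bar> * f (g x)"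
  have "(f has_integral Gamma ((s + 1) / 2)) {0..}"
    unfolding f_def using s by (intro Gamma_integral_real) auto
  moreover have "{x \<in> {0<..} - {0..} \<union> ({0..} - {0<..}). f x \<noteq> 0} \<subseteq> {0}" by auto
  ultimately have f_int: "(f has_integral Gamma ((s + 1) / 2)) {0<..}"
    by (subst (asm) has_integral_spike_set_eq[where T="{0<..}"])
       (auto intro: negligible_subset[of "{0}"])
  then have f_abs: "f absolutely_integrable_on {0<..}"
    by (intro nonnegative_absolutely_integrable_1) (auto simp: f_def has_integral_integrable)
  have image: "g ` {0<..} = {0<..}"
  proof
    show "{0<..} \<subseteq> g ` {0<..}"
    proof
      fix t :: real assume "t \<in> {0<..}"
      then show "t \<in> g ` {0<..}"
        by (intro image_eqI[of _ _ "sqrt (2 * t)"]) (auto simp: g_def)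
    qed
  qed (auto simp: g_def)
  have "?h absolutely_integrable_on {0<..} \<and> integral {0<..} ?h = Gamma ((s + 1) / 2)"
  proof (subst has_absolute_integral_change_of_variables_1'[where g = g and g' = "\<lambda>x. x" and f = f])
    show "(g has_field_derivative x) (at x within {0<..})" for x
      unfolding g_def by (auto intro!: derivative_eq_intros)
    show "inj_on g {0<..}"
      by (auto simp: inj_on_def g_def power2_eq_iff)
    show "f absolutely_integrable_on g ` {0<..} \<and> integral (g ` {0<..}) f = Gamma ((s + 1) / 2)"
      unfolding image using f_abs f_int by blast
  qed auto
  then have h: "integrable lebesgue (\<lambda>x. indicator {0<..} x *\<^sub>R ?h x)"
      "integral\<^sup>L lebesgue (\<lambda>x. indicator {0<..} x *\<^sub>R ?h x) = Gamma ((s + 1) / 2)"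
    using set_lebesgue_integral_eq_integral(2)[of "{0<..}" ?h]
    by (simp_all add: set_integrable_def set_lebesgue_integral_def)
  have meas: "(\<lambda>x. indicator {0<..} x *\<^sub>R ?h x) \<in> borel_measurable lborel"
    unfolding f_def g_def by measurable
  have "has_bochner_integral lborel (\<lambda>x. indicator {0<..} x *\<^sub>R ?h x) (Gamma ((s + 1) / 2))"
    using h meas by (simp add: has_bochner_integral_iff integrable_completion integral_completion)
  from has_bochner_integral_mult_left[OF this, of "2 powr ((s - 1) / 2) / sqrt (2 * pi)"]
  have "has_bochner_integral lborel (\<lambda>x. indicator {0..} x *\<^sub>R (std_normal_density x * \<bar>x\<bar> powr s))
          (Gamma ((s + 1) / 2) * (2 powr ((s - 1) / 2) / sqrt (2 * pi)))"
  proof (rule has_bochner_integral_cong[THEN iffD1, rotated -1])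
    fix x :: real
    have "x * (x\<^sup>2 / 2) powr ((s + 1) / 2 - 1) * 2 powr ((s - 1) / 2) = x powr s" if "x > 0"
    proof -
      have "(x\<^sup>2 / 2) powr ((s + 1) / 2 - 1) = x powr (s - 1) / 2 powr ((s - 1) / 2)"
        using that by (simp add: powr_divide powr_powr add_divide_distrib diff_divide_distrib flip: powr_numeral)
      moreover have "x powr (s - 1) = x powr s / x"
        using that by (simp add: powr_diff)
      ultimately show ?thesis using that by simp
    qed
    then have "x > 0 \<Longrightarrow> x * (x\<^sup>2 / 2) powr ((s + 1) / 2 - 1) / exp (x\<^sup>2 / 2) * (2 powr ((s - 1) / 2) / sqrt (2 * pi))
       = 1 / sqrt (2 * pi) * exp (- x\<^sup>2 / 2) * x powr s"
      by (simp add: exp_minus field_simps)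
    then show "indicator {0<..} x *\<^sub>R ?h x * (2 powr ((s - 1) / 2) / sqrt (2 * pi)) =
        indicator {0..} x *\<^sub>R (std_normal_density x * \<bar>x\<bar> powr s)"
      using s by (cases "x > 0"; cases "x = 0")
        (auto simp: f_def g_def std_normal_density_def indicator_def)
  qed auto
  from has_bochner_integral_even_function[OF this]
  have "has_bochner_integral lborel (\<lambda>x. std_normal_density x * \<bar>x\<bar> powr s)
      (2 * (Gamma ((s + 1) / 2) * (2 powr ((s - 1) / 2) / sqrt (2 * pi))))"
    by (simp add: std_normal_density_def)
  also have "2 * (Gamma ((s + 1) / 2) * (2 powr ((s - 1) / 2) / sqrt (2 * pi))) = gamma_const s powr s"
    unfolding gamma_const_powr[OF s]
    by (simp add: real_sqrt_mult diff_divide_distrib powr_diff powr_half_sqrt) (simp flip: mult.assoc)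
  finally show ?thesis .
qed

text \<open>
  Independent standard normal coordinates, indexed by a finite type. The index set serves to combine
  the vectors of a factorisation with random coefficients.
\<close>

definition std_gaussian :: "('k::finite \<Rightarrow> real) measure" where
  "std_gaussian = (\<Pi>\<^sub>M i\<in>UNIV. density lborel std_normal_density)"

lemma prob_space_std_normal: "prob_space (density lborel std_normal_density)"
  by (rule prob_space_normal_density) simp

lemma prob_space_std_gaussian: "prob_space (std_gaussian :: ('k::finite \<Rightarrow> real) measure)"
  unfolding std_gaussian_def by (intro prob_space_PiM prob_space_std_normal)

lemma sets_std_gaussian [measurable_cong]:
  "sets (std_gaussian :: ('k::finite \<Rightarrow> real) measure) = sets (\<Pi>\<^sub>M i\<in>UNIV. borel)"
  unfolding std_gaussian_def by (intro sets_PiM_cong) auto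

lemma std_gaussian_coordinate:
  "distr (std_gaussian :: ('k::finite \<Rightarrow> real) measure) borel (\<lambda>g. g k) = density lborel std_normal_density"
proof -
  have "distr (std_gaussian :: ('k \<Rightarrow> real) measure) (density lborel std_normal_density) (\<lambda>g. g k)
      = density lborel std_normal_density"
    unfolding std_gaussian_def by (intro distr_PiM_component prob_space_std_normal) auto
  moreover have "distr (std_gaussian :: ('k \<Rightarrow> real) measure) borel (\<lambda>g. g k)
      = distr std_gaussian (density lborel std_normal_density) (\<lambda>g. g k)"
    by (intro distr_cong) auto
  ultimately show ?thesis by simp
qed

lemma std_gaussian_indep:
  "prob_space.indep_vars (std_gaussian :: ('k::finite \<Rightarrow> real) measure) (\<lambda>_. borel) (\<lambda>k g. g k) UNIV"
proof -
  interpret prob_space "std_gaussian :: ('k \<Rightarrow> real) measure" by (rule prob_space_std_gaussian)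
  have "distr (std_gaussian :: ('k \<Rightarrow> real) measure) (\<Pi>\<^sub>M i\<in>UNIV. borel) (\<lambda>x. x) = std_gaussian"
    by (intro distr_id2) (simp add: sets_std_gaussian)
  then show ?thesis
    by (subst indep_vars_iff_distr_eq_PiM) (auto simp: std_gaussian_coordinate restrict_UNIV, simp add: std_gaussian_def)
qed

text \<open>
  Sums of independent normal variables are normal. Coordinates with coefficient zero have to be left
  out, because the normal density degenerates at variance \<open>0\<close>.
\<close>

lemma std_gaussian_linear_form:
  fixes a :: "'k::finite \<Rightarrow> real"
  assumes "a \<noteq> (\<lambda>_. 0)"
  shows "distributed std_gaussian lborel (\<lambda>g. \<Sum>k\<in>UNIV. a k * g k)
           (normal_density 0 (sqrt (\<Sum>k\<in>UNIV. (a k)\<^sup>2)))"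
proof -
  interpret prob_space "std_gaussian :: ('k \<Rightarrow> real) measure" by (rule prob_space_std_gaussian)
  define I where "I = {k. a k \<noteq> 0}"
  have std: "distributed std_gaussian lborel (\<lambda>g. g k) std_normal_density" for k :: 'k
    unfolding distributed_def using std_gaussian_coordinate[of k]
    by (auto cong: distr_cong simp: sets_std_gaussian)
  have "distributed std_gaussian lborel (\<lambda>g. \<Sum>k\<in>I. a k * g k)
          (normal_density (\<Sum>k\<in>I. 0) (sqrt (\<Sum>k\<in>I. \<bar>a k\<bar>\<^sup>2)))"
  proof (rule sum_indep_normal)
    show "I \<noteq> {}" using assms by (auto simp: I_def fun_eq_iff)
    have "indep_vars (\<lambda>_. borel) (\<lambda>k g. g k) I"
      by (rule indep_vars_subset[OF std_gaussian_indep]) auto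
    then show "indep_vars (\<lambda>_. borel) (\<lambda>k g. a k * g k) I"
      by (rule indep_vars_compose2) auto
    show "distributed std_gaussian lborel (\<lambda>g. a k * g k) (normal_density 0 \<bar>a k\<bar>)" if "k \<in> I" for k
      using normal_density_affine[OF std, of "a k" 0 k] that by (simp add: I_def)
  qed (auto simp: I_def)
  moreover have "(\<Sum>k\<in>I. a k * g k) = (\<Sum>k\<in>UNIV. a k * g k)" for g
    by (rule sum.mono_neutral_left) (auto simp: I_def)
  moreover have "(\<Sum>k\<in>I. \<bar>a k\<bar>\<^sup>2) = (\<Sum>k\<in>UNIV. (a k)\<^sup>2)"
    by (simp, rule sum.mono_neutral_left) (auto simp: I_def)
  ultimately show ?thesis by simp
qed

lemma std_gaussian_moment:
  fixes a :: "'k::finite \<Rightarrow> real"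
  assumes s: "s > 0"
  shows "has_bochner_integral std_gaussian (\<lambda>g. \<bar>\<Sum>k\<in>UNIV. a k * g k\<bar> powr s)
           (gamma_const s powr s * (\<Sum>k\<in>UNIV. (a k)\<^sup>2) powr (s / 2))"
proof (cases "a = (\<lambda>_. 0)")
  case True
  then show ?thesis by (simp add: has_bochner_integral_zero)
next
  case False
  interpret prob_space "std_gaussian :: ('k \<Rightarrow> real) measure" by (rule prob_space_std_gaussian)
  define \<sigma> where "\<sigma> = sqrt (\<Sum>k\<in>UNIV. (a k)\<^sup>2)"
  have "(\<Sum>k\<in>UNIV. (a k)\<^sup>2) > 0"
    using False by (auto simp: fun_eq_iff intro!: sum_pos2)
  then have \<sigma>: "\<sigma> > 0" by (simp add: \<sigma>_def)
  have D: "distributed std_gaussian lborel (\<lambda>g. (\<Sum>k\<in>UNIV. a k * g k) / \<sigma>) std_normal_density"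
    using std_gaussian_linear_form[OF False] normal_standard_normal_convert[OF \<sigma>, of _ 0]
    by (simp add: \<sigma>_def)
  have "has_bochner_integral std_gaussian (\<lambda>g. \<bar>(\<Sum>k\<in>UNIV. a k * g k) / \<sigma>\<bar> powr s) (gamma_const s powr s)"
    using std_normal_absolute_moment[OF s]
      distributed_integrable[OF D, of "\<lambda>x. \<bar>x\<bar> powr s"]
      distributed_integral[OF D, of "\<lambda>x. \<bar>x\<bar> powr s"]
    by (simp add: has_bochner_integral_iff)
  from has_bochner_integral_mult_left[OF this, of "\<sigma> powr s"]
  have "has_bochner_integral std_gaussian (\<lambda>g. \<bar>\<Sum>k\<in>UNIV. a k * g k\<bar> powr s) (gamma_const s powr s * \<sigma> powr s)"
    using \<sigma> by (simp add: powr_divide)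
  moreover have "\<sigma> powr s = (\<Sum>k\<in>UNIV. (a k)\<^sup>2) powr (s / 2)"
    unfolding \<sigma>_def by (simp add: powr_powr sum_nonneg flip: powr_half_sqrt)
  ultimately show ?thesis by simp
qed

text \<open>
  By polarisation the covariance reduces to second moments of linear forms.
\<close>

lemma std_gaussian_covariance:
  fixes a b :: "'k::finite \<Rightarrow> real"
  shows "has_bochner_integral std_gaussian (\<lambda>g. (\<Sum>k\<in>UNIV. a k * g k) * (\<Sum>k\<in>UNIV. b k * g k))
           (\<Sum>k\<in>UNIV. a k * b k)"
proof -
  have sq: "has_bochner_integral std_gaussian (\<lambda>g. (\<Sum>k\<in>UNIV. c k * g k)\<^sup>2) (\<Sum>k\<in>UNIV. (c k)\<^sup>2)"
    for c :: "'k \<Rightarrow> real"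
    using std_gaussian_moment[of 2 c] by (simp add: gamma_const_2 sum_nonneg)
  have "has_bochner_integral std_gaussian
      (\<lambda>g. ((\<Sum>k\<in>UNIV. (a k + b k) * g k)\<^sup>2 - (\<Sum>k\<in>UNIV. (a k - b k) * g k)\<^sup>2) / 4)
      (((\<Sum>k\<in>UNIV. (a k + b k)\<^sup>2) - (\<Sum>k\<in>UNIV. (a k - b k)\<^sup>2)) / 4)"
    by (intro has_bochner_integral_divide_zero has_bochner_integral_diff sq)
  moreover have "((\<Sum>k\<in>UNIV. (a k + b k) * g k)\<^sup>2 - (\<Sum>k\<in>UNIV. (a k - b k) * g k)\<^sup>2) / 4
      = (\<Sum>k\<in>UNIV. a k * g k) * (\<Sum>k\<in>UNIV. b k * g k)" for g
    by (simp add: distrib_right left_diff_distrib sum.distrib sum_subtractf power2_eq_square algebra_simps)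
  moreover have "((\<Sum>k\<in>UNIV. (a k + b k)\<^sup>2) - (\<Sum>k\<in>UNIV. (a k - b k)\<^sup>2)) / 4 = (\<Sum>k\<in>UNIV. a k * b k)"
    by (simp add: sum_divide_distrib power2_eq_square algebra_simps flip: sum_subtractf)
  ultimately show ?thesis by simp
qed

section \<open>The relative operator norm and Gaussian rounding\<close>

lemma pq_norm_nonneg:
  assumes "inj ((*v) B)" "p > 0" "q > 0"
  shows "pq_norm p q B A \<ge> 0"
  using pq_norm_attained[OF assms, of A] pnorm_nonneg by metis

text \<open>
  Homogeneity; injectivity of \<open>B\<close> ensures that \<open>B *v x\<close> can be normalised when \<open>x \<noteq> 0\<close>.
\<close>

lemma pnorm_le_pq_norm:
  fixes A :: "real^'n^'m" and B :: "real^'n^'l"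
  assumes "inj ((*v) B)" "p > 0" "q > 0"
  shows "pnorm q (A *v x) \<le> pq_norm p q B A * pnorm p (B *v x)"
proof (cases "x = 0")
  case True
  then show ?thesis using pnorm_scaleR[OF assms(3), of 0 "0::real^'m"] pnorm_scaleR[OF assms(2), of 0 "0::real^'l"] by simp
next
  case False
  define r where "r = pnorm p (B *v x)"
  have "B *v x \<noteq> 0"
    using False inj_matrix_vector_mult assms(1) by (metis injD matrix_vector_mult_0_right)
  then have r: "r > 0"
    using pnorm_eq_0[OF assms(2), of "B *v x"] pnorm_nonneg[of p "B *v x"]
    by (auto simp: r_def less_le)
  have "pnorm p (B *v ((1 / r) *\<^sub>R x)) \<le> 1"
    using r by (simp add: matrix_vector_mult_scaleR pnorm_scaleR assms(2) flip: r_def)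
  then have "pnorm q (A *v ((1 / r) *\<^sub>R x)) \<le> pq_norm p q B A"
    using pq_norm_attained[OF assms, of A] by metis
  then show ?thesis
    using r by (simp add: matrix_vector_mult_scaleR pnorm_scaleR assms(3) field_simps flip: r_def)
qed

lemma bilinear_le_pq_norm:
  fixes A :: "real^'n^'m" and B :: "real^'n^'l"
  assumes "inj ((*v) B)" "p > 0" "s > 1"
  shows "y \<bullet> (A *v x) \<le> pq_norm p (conjugate s) B A * (pnorm (ereal s) y * pnorm p (B *v x))"
proof -
  have "y \<bullet> (A *v x) \<le> pnorm (conjugate s) (A *v x) * pnorm (ereal s) y"
    using Hoelder_sum[of s "A *v x" y] assms by (simp add: inner_vec_def mult.commute)
  also have "\<dots> \<le> (pq_norm p (conjugate s) B A * pnorm p (B *v x)) * pnorm (ereal s) y"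
    using assms conjugate_pos[of s] by (intro mult_right_mono pnorm_le_pq_norm pnorm_nonneg) auto
  finally show ?thesis by (simp add: mult_ac)
qed

text \<open>
  Each coordinate of the random vector is a linear form, and the \<open>s\<close>-th moment of such a form depends
  on its variance only. Hence the moment of the norm is a function of the diagonal of the covariance
  matrix, which is exactly what the dual norm in the objective sees.
\<close>

lemma std_gaussian_pnorm_moment:
  fixes V :: "'k::finite \<Rightarrow> real^'m"
  assumes "s > 0"
  shows "has_bochner_integral std_gaussian (\<lambda>g. pnorm (ereal s) (\<Sum>k\<in>UNIV. g k *\<^sub>R V k) powr s)
     (gamma_const s powr s * pnorm (ereal (s / 2)) (\<chi> i. \<Sum>k\<in>UNIV. (V k $ i)\<^sup>2) powr (s / 2))"
proof -
  have "has_bochner_integral std_gaussian (\<lambda>g. \<Sum>i\<in>UNIV. \<bar>\<Sum>k\<in>UNIV. V k $ i * g k\<bar> powr s)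
     (\<Sum>i\<in>UNIV. gamma_const s powr s * (\<Sum>k\<in>UNIV. (V k $ i)\<^sup>2) powr (s / 2))"
    using assms by (intro has_bochner_integral_sum std_gaussian_moment)
  moreover have "pnorm (ereal s) (\<Sum>k\<in>UNIV. g k *\<^sub>R V k) powr s
      = (\<Sum>i\<in>UNIV. \<bar>\<Sum>k\<in>UNIV. V k $ i * g k\<bar> powr s)" for g
    using assms by (simp add: pnorm_powr sum_component mult.commute)
  moreover have "pnorm (ereal (s / 2)) (\<chi> i. \<Sum>k\<in>UNIV. (V k $ i)\<^sup>2) powr (s / 2)
      = (\<Sum>i\<in>UNIV. (\<Sum>k\<in>UNIV. (V k $ i)\<^sup>2) powr (s / 2))"
    using assms by (subst pnorm_powr) (simp_all add: sum_nonneg)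
  ultimately show ?thesis by (simp add: sum_distrib_left)
qed

text \<open>
  The tangent at \<open>1\<close> of the concave function \<open>u \<mapsto> u powr (2 / s)\<close>, evaluated at \<open>u = t powr s\<close>. Taking
  expectations, it compares the second moment with the \<open>s\<close>-th one.
\<close>

lemma power2_le_powr:
  fixes t :: real
  assumes "t \<ge> 0" "s \<ge> 2"
  shows "t\<^sup>2 / 2 \<le> 1 / 2 + (t powr s - 1) / s"
proof (cases "t = 0")
  case True
  then show ?thesis using assms by (simp add: field_simps)
next
  case False
  then have "(t powr s) powr (2 / s) * 1 powr (1 - 2 / s) \<le> 2 / s * t powr s + (1 - 2 / s) * 1"
    using assms by (intro Youngs_inequality_0) auto
  then have "t\<^sup>2 \<le> 2 / s * t powr s + (1 - 2 / s)" using False assms by (simp add: powr_powr)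
  then have "t\<^sup>2 / 2 \<le> (2 / s * t powr s + (1 - 2 / s)) / 2" by (rule divide_right_mono) simp
  also have "\<dots> = 1 / 2 + (t powr s - 1) / s" by (simp add: add_divide_distrib diff_divide_distrib)
  finally show ?thesis .
qed

text \<open>
  Let \<open>y\<close> and \<open>x\<close> be the combinations of the vectors \<open>Y k\<close> and \<open>X k\<close> with common Gaussian coefficients.
  The left-hand side is the expectation of \<open>y \<bullet> (A *v x)\<close>. Pointwise this is at most
  the operator norm times \<open>f * h\<close>, where \<open>f\<close> and \<open>h\<close> are the norms of \<open>y\<close> and \<open>B *v x\<close>. The moment formula
  gives \<open>E (f powr s) \<le> c powr s\<close> and \<open>E (h powr p) \<le> d powr p\<close> for \<open>c = gamma_const s * sqrt a\<close>
  and \<open>d = gamma_const p * sqrt b\<close>, and since both exponents are at least \<open>2\<close>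
  this implies \<open>E (f * h) \<le> c * d\<close>.
\<close>

lemma gaussian_rounding:
  fixes A :: "real^'n^'m" and B :: "real^'n^'l" and Y :: "'k::finite \<Rightarrow> real^'m" and X :: "'k \<Rightarrow> real^'n"
  assumes inj: "inj ((*v) B)" and p: "p \<ge> 2" and s: "s \<ge> 2" and ab: "a > 0" "b > 0"
    and Y: "pnorm (ereal (s / 2)) (\<chi> i. \<Sum>k\<in>UNIV. (Y k $ i)\<^sup>2) \<le> a"
    and X: "pnorm (ereal (p / 2)) (\<chi> j. \<Sum>k\<in>UNIV. ((B *v X k) $ j)\<^sup>2) \<le> b"
  shows "(\<Sum>k\<in>UNIV. Y k \<bullet> (A *v X k))
    \<le> gamma_const p * gamma_const s * pq_norm (ereal p) (conjugate s) B A * sqrt (a * b)"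
proof -
  interpret prob_space "std_gaussian :: ('k \<Rightarrow> real) measure" by (rule prob_space_std_gaussian)
  define N where "N = pq_norm (ereal p) (conjugate s) B A"
  define y where "y g = (\<Sum>k\<in>UNIV. g k *\<^sub>R Y k)" for g :: "'k \<Rightarrow> real"
  define x where "x g = (\<Sum>k\<in>UNIV. g k *\<^sub>R X k)" for g :: "'k \<Rightarrow> real"
  define f where "f g = pnorm (ereal s) (y g)" for g
  define h where "h g = pnorm (ereal p) (B *v x g)" for g
  define c where "c = gamma_const s * sqrt a"
  define d where "d = gamma_const p * sqrt b"
  have cd: "c > 0" "d > 0"
    using gamma_const_pos p s ab by (auto simp: c_def d_def)
  have N: "N \<ge> 0" unfolding N_def using p s conjugate_pos[of s] by (intro pq_norm_nonneg inj) auto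
  have lin: "M *v x g = (\<Sum>k\<in>UNIV. g k *\<^sub>R (M *v X k))" for g and M :: "real^'n^'r"
    by (simp add: x_def matrix_vector_mult_scaleR linear_sum[OF matrix_vector_mul_linear, of M])
  have Ef: "integrable std_gaussian (\<lambda>g. f g powr s)" "expectation (\<lambda>g. f g powr s) \<le> c powr s"
  proof -
    note * = std_gaussian_pnorm_moment[of s Y]
    show "integrable std_gaussian (\<lambda>g. f g powr s)"
      using * s by (auto simp: f_def y_def has_bochner_integral_iff)
    have "expectation (\<lambda>g. f g powr s)
        = gamma_const s powr s * pnorm (ereal (s / 2)) (\<chi> i. \<Sum>k\<in>UNIV. (Y k $ i)\<^sup>2) powr (s / 2)"
      using * s by (auto simp: f_def y_def has_bochner_integral_iff)
    also have "\<dots> \<le> gamma_const s powr s * a powr (s / 2)"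
      using Y s pnorm_nonneg by (intro mult_left_mono powr_mono2) auto
    also have "\<dots> = c powr s"
      using gamma_const_pos[of s] ab s by (simp add: c_def powr_mult powr_powr flip: powr_half_sqrt)
    finally show "expectation (\<lambda>g. f g powr s) \<le> c powr s" .
  qed
  have Eh: "integrable std_gaussian (\<lambda>g. h g powr p)" "expectation (\<lambda>g. h g powr p) \<le> d powr p"
  proof -
    note * = std_gaussian_pnorm_moment[of p "\<lambda>k. B *v X k"]
    show "integrable std_gaussian (\<lambda>g. h g powr p)"
      using * p by (auto simp: h_def lin has_bochner_integral_iff)
    have "expectation (\<lambda>g. h g powr p)
        = gamma_const p powr p * pnorm (ereal (p / 2)) (\<chi> j. \<Sum>k\<in>UNIV. ((B *v X k) $ j)\<^sup>2) powr (p / 2)"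
      using * p by (auto simp: h_def lin has_bochner_integral_iff)
    also have "\<dots> \<le> gamma_const p powr p * b powr (p / 2)"
      using X p pnorm_nonneg by (intro mult_left_mono powr_mono2) auto
    also have "\<dots> = d powr p"
      using gamma_const_pos[of p] ab p by (simp add: d_def powr_mult powr_powr flip: powr_half_sqrt)
    finally show "expectation (\<lambda>g. h g powr p) \<le> d powr p" .
  qed
  have "has_bochner_integral std_gaussian
      (\<lambda>g. \<Sum>i\<in>UNIV. (\<Sum>k\<in>UNIV. Y k $ i * g k) * (\<Sum>k\<in>UNIV. (A *v X k) $ i * g k))
      (\<Sum>i\<in>UNIV. \<Sum>k\<in>UNIV. Y k $ i * (A *v X k) $ i)"
    by (intro has_bochner_integral_sum std_gaussian_covariance)
  moreover have "(\<Sum>i\<in>UNIV. (\<Sum>k\<in>UNIV. Y k $ i * g k) * (\<Sum>k\<in>UNIV. (A *v X k) $ i * g k))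
      = y g \<bullet> (A *v x g)" for g
    unfolding lin by (simp add: inner_vec_def y_def sum_component mult.commute)
  moreover have "(\<Sum>i\<in>UNIV. \<Sum>k\<in>UNIV. Y k $ i * (A *v X k) $ i) = (\<Sum>k\<in>UNIV. Y k \<bullet> (A *v X k))"
    by (subst sum.swap) (simp add: inner_vec_def)
  ultimately have E: "has_bochner_integral std_gaussian (\<lambda>g. y g \<bullet> (A *v x g)) (\<Sum>k\<in>UNIV. Y k \<bullet> (A *v X k))"
    by simp
  have pointwise: "y g \<bullet> (A *v x g)
      \<le> N * (c * d) * (1 + (f g powr s / c powr s - 1) / s + (h g powr p / d powr p - 1) / p)" for g
  proof -
    have fh: "f g \<ge> 0" "h g \<ge> 0" by (simp_all add: f_def h_def pnorm_nonneg)
    \<comment> \<open>normalised so that both moments on the right have expectation at most \<open>1\<close>\<close>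
    have "(f g / c) * (h g / d) \<le> (f g / c)\<^sup>2 / 2 + (h g / d)\<^sup>2 / 2"
      using sum_squares_bound[of "f g / c" "h g / d"] by simp
    also have "\<dots> \<le> (1 / 2 + ((f g / c) powr s - 1) / s) + (1 / 2 + ((h g / d) powr p - 1) / p)"
      using fh cd p s by (intro add_mono power2_le_powr) auto
    also have "\<dots> = 1 + (f g powr s / c powr s - 1) / s + (h g powr p / d powr p - 1) / p"
      using fh cd by (simp add: powr_divide)
    finally have "f g * h g \<le> c * d * (1 + (f g powr s / c powr s - 1) / s + (h g powr p / d powr p - 1) / p)"
      using cd by (simp add: pos_divide_le_eq mult.commute)
    moreover have "y g \<bullet> (A *v x g) \<le> N * (f g * h g)"
      unfolding N_def f_def h_def using p s by (intro bilinear_le_pq_norm inj) auto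
    ultimately show ?thesis
      using mult_left_mono[OF _ N] by (smt (verit) mult.assoc)
  qed
  have "(\<Sum>k\<in>UNIV. Y k \<bullet> (A *v X k)) = expectation (\<lambda>g. y g \<bullet> (A *v x g))"
    using E by (simp add: has_bochner_integral_iff)
  also have "\<dots> \<le> expectation (\<lambda>g. N * (c * d) *
      (1 + (f g powr s / c powr s - 1) / s + (h g powr p / d powr p - 1) / p))"
    using E Ef(1) Eh(1) pointwise
    by (intro integral_mono) (auto simp: has_bochner_integral_iff)
  also have "\<dots> = N * (c * d) * (1 + (expectation (\<lambda>g. f g powr s) / c powr s - 1) / s
      + (expectation (\<lambda>g. h g powr p) / d powr p - 1) / p)"
    using Ef(1) Eh(1) by (simp add: prob_space)
  also have "\<dots> \<le> N * (c * d) * (1 + (1 - 1) / s + (1 - 1) / p)"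
    using Ef(2) Eh(2) cd N p s
    by (intro mult_left_mono add_mono divide_right_mono diff_right_mono) auto
  also have "\<dots> = gamma_const p * gamma_const s * N * sqrt (a * b)"
    by (simp add: c_def d_def real_sqrt_mult)
  finally show ?thesis by (simp add: N_def)
qed

section \<open>Duality and the two bounds\<close>

text \<open>
  A hyperplane separates the compact set from the closed convex cone. The cone property makes the
  normal \<open>a\<close> nonnegative on the cone and strictly negative on \<open>T\<close>. Symmetrising \<open>a\<close> changes
  its values on symmetric matrices only by the factor \<open>2\<close>, and rank one matrices in the cone show that the
  symmetrised normal is itself positive semidefinite; its factorisation yields the vectors \<open>c k\<close>.
\<close>

lemma separate_from_pos_semidef:
  fixes T :: "(real^'k^'k) set"
  assumes T: "compact T" "convex T" "T \<noteq> {}" and disj: "\<And>M. M \<in> T \<Longrightarrow> \<not> pos_semidef M"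
    and sym: "\<And>M. M \<in> T \<Longrightarrow> transpose M = M"
  shows "\<exists>c :: 'k \<Rightarrow> real^'k. \<forall>M\<in>T. (\<Sum>k\<in>UNIV. c k \<bullet> (M *v c k)) < 0"
proof -
  obtain a b where ab: "\<And>M. M \<in> T \<Longrightarrow> a \<bullet> M < b" "\<And>P. pos_semidef P \<Longrightarrow> b < a \<bullet> P"
    using separating_hyperplane_compact_closed[OF T(2,1,3) convex_pos_semidef closed_pos_semidef] disj
    by blast
  have b: "b < 0" using ab(2)[of 0] by (simp add: pos_semidef_def transpose_def vec_eq_iff)
  have nonneg: "a \<bullet> P \<ge> 0" if P: "pos_semidef P" for P
  proof (rule ccontr)
    assume "\<not> a \<bullet> P \<ge> 0"
    then have neg: "a \<bullet> P < 0" by simp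
    then have "b / (a \<bullet> P) \<ge> 0" using b by (simp add: divide_nonpos_neg)
    \<comment> \<open>this multiple of \<open>P\<close> lies in the cone and on the hyperplane\<close>
    then have "b < a \<bullet> ((b / (a \<bullet> P)) *\<^sub>R P)" by (intro ab(2) pos_semidef_scaleR P)
    then show False using neg by simp
  qed
  define X where "X = a + transpose a"
  have trans: "transpose a \<bullet> M = a \<bullet> transpose M" for M
    by (simp add: inner_matrix transpose_def) (rule sum.swap)
  have "0 \<le> z \<bullet> (X *v z)" for z
  proof -
    have "z \<bullet> (X *v z) = X \<bullet> outer z" by (simp add: inner_outer)
    also have "\<dots> = a \<bullet> outer z + a \<bullet> transpose (outer z)"
      by (simp add: X_def inner_add_left trans)
    finally show ?thesis
      using nonneg[OF pos_semidef_outer[of z]] pos_semidef_outer[of z] by (simp add: pos_semidef_def)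
  qed
  then have "pos_semidef X"
    by (simp add: pos_semidef_def X_def transpose_def vec_eq_iff add.commute)
  then obtain c :: "'k \<Rightarrow> real^'k" where c: "X = (\<Sum>k\<in>UNIV. outer (c k))"
    using pos_semidef_sum_outer by blast
  have "(\<Sum>k\<in>UNIV. c k \<bullet> (M *v c k)) < 0" if M: "M \<in> T" for M
  proof -
    have "(\<Sum>k\<in>UNIV. c k \<bullet> (M *v c k)) = M \<bullet> X"
      by (simp add: c inner_sum_right inner_outer)
    also have "\<dots> = X \<bullet> M" by (rule inner_commute)
    also have "\<dots> = 2 * (a \<bullet> M)" using sym[OF M] by (simp add: X_def inner_add_left trans)
    finally show ?thesis using ab(1)[OF M] b by simp
  qed
  then show ?thesis by blast
qed

text \<open>
  This is strong duality of the semidefinite relaxation together with the rounding bound. If no pair of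
  weights in the two balls of radius \<open>c\<close> were in \<open>K_set A B\<close>, the compact convex set of their matrices would be
  separated from the cone by vectors \<open>z k\<close>, with upper parts \<open>Y k\<close> and lower parts \<open>X k\<close>. Choosing extremal
  weights for the diagonals \<open>\<alpha>\<close> and \<open>\<beta>\<close> of the two covariance matrices, of norms \<open>a\<close> and \<open>b\<close>, gives
  \<open>c * (a + b) < 2 * \<tau>\<close>. But rounding gives \<open>\<tau> \<le> c * sqrt (a * b)\<close>, and this is at most
  \<open>c * (a + b) / 2\<close>.
\<close>

lemma exists_small_dual_feasible:
  fixes A :: "real^'n^'m" and B :: "real^'n^'l"
  assumes inj: "inj ((*v) B)" and p: "p \<ge> 2" and s: "s \<ge> 2"
  defines "c \<equiv> gamma_const p * gamma_const s * pq_norm (ereal p) (conjugate s) B A"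
  shows "\<exists>v w. (v, w) \<in> K_set A B \<and> pnorm (conjugate (s / 2)) v \<le> c \<and> pnorm (conjugate (p / 2)) w \<le> c"
proof (rule ccontr)
  assume no: "\<not> ?thesis"
  have c: "c \<ge> 0"
    unfolding c_def using p s gamma_const_pos[of p] gamma_const_pos[of s] conjugate_pos[of s]
    by (intro mult_nonneg_nonneg pq_norm_nonneg inj) auto
  have conj_ge_1: "conjugate r \<ge> 1" if "r \<ge> 1" for r
    using that by (cases "r = 1") (auto simp: conjugate_1 conjugate_gt_1)
  define V where "V = {v :: real^'m. pnorm (conjugate (s / 2)) v \<le> c}"
  define W where "W = {w :: real^'l. pnorm (conjugate (p / 2)) w \<le> c}"
  define T where "T = (\<lambda>(v, w). K_matrix A B v w) ` (V \<times> W)"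
  have "compact (V \<times> W)"
    unfolding V_def W_def using p s by (intro compact_Times compact_pnorm_ball conjugate_pos) auto
  then have "compact T" unfolding T_def by (intro compact_continuous_image continuous_on_K_matrix)
  moreover have "convex T"
  proof -
    have "convex V" "convex W"
      unfolding V_def W_def using p s c by (auto intro!: convex_pnorm_ball conj_ge_1)
    then have VW: "convex (V \<times> W)" by (rule convex_Times)
    show ?thesis
    proof (rule convexI)
      fix M M' and t u :: real
      assume "M \<in> T" "M' \<in> T" and tu: "t \<ge> 0" "u \<ge> 0" "t + u = 1"
      then obtain v w v' w' where vw: "(v, w) \<in> V \<times> W" "(v', w') \<in> V \<times> W"
          and M: "M = K_matrix A B v w" "M' = K_matrix A B v' w'"
        by (auto simp: T_def)
      have "(t *\<^sub>R v + u *\<^sub>R v', t *\<^sub>R w + u *\<^sub>R w') \<in> V \<times> W"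
        using convexD[OF VW vw tu] by simp
      moreover have "t *\<^sub>R M + u *\<^sub>R M' = K_matrix A B (t *\<^sub>R v + u *\<^sub>R v') (t *\<^sub>R w + u *\<^sub>R w')"
        using tu by (simp add: M K_matrix_convex_combination)
      ultimately show "t *\<^sub>R M + u *\<^sub>R M' \<in> T"
        by (auto simp: T_def)
    qed
  qed
  moreover have zero: "0 \<in> V" "0 \<in> W"
    using c p s pnorm_scaleR[of "conjugate (s / 2)" 0 "0 :: real^'m"]
      pnorm_scaleR[of "conjugate (p / 2)" 0 "0 :: real^'l"] conjugate_pos[of "s / 2"] conjugate_pos[of "p / 2"]
    by (auto simp: V_def W_def)
  then have "T \<noteq> {}" by (auto simp: T_def)
  moreover have "\<not> pos_semidef M" "transpose M = M" if "M \<in> T" for M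
    using that no by (auto simp: T_def V_def W_def in_K_set transpose_K_matrix)
  ultimately obtain z :: "'m + 'n \<Rightarrow> real^('m + 'n)"
    where z: "\<And>M. M \<in> T \<Longrightarrow> (\<Sum>k\<in>UNIV. z k \<bullet> (M *v z k)) < 0"
    using separate_from_pos_semidef[of T] by blast
  define Y where "Y k = (\<chi> i. z k $ Inl i)" for k
  define X where "X k = (\<chi> j. z k $ Inr j)" for k
  define \<alpha> where "\<alpha> = (\<chi> i. \<Sum>k\<in>UNIV. (Y k $ i)\<^sup>2)"
  define \<beta> where "\<beta> = (\<chi> l. \<Sum>k\<in>UNIV. ((B *v X k) $ l)\<^sup>2)"
  define \<tau> where "\<tau> = (\<Sum>k\<in>UNIV. Y k \<bullet> (A *v X k))"
  define a where "a = pnorm (ereal (s / 2)) \<alpha>"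
  define b where "b = pnorm (ereal (p / 2)) \<beta>"
  have ab: "a \<ge> 0" "b \<ge> 0" by (simp_all add: a_def b_def pnorm_nonneg)
  have less: "(\<Sum>i\<in>UNIV. v $ i * \<alpha> $ i) + (\<Sum>l\<in>UNIV. w $ l * \<beta> $ l) < 2 * \<tau>"
    if vw: "v \<in> V" "w \<in> W" for v w
  proof -
    have "(\<Sum>k\<in>UNIV. z k \<bullet> (K_matrix A B v w *v z k)) =
        (\<Sum>k\<in>UNIV. \<Sum>i\<in>UNIV. v $ i * (Y k $ i)\<^sup>2) - 2 * \<tau>
        + (\<Sum>k\<in>UNIV. \<Sum>l\<in>UNIV. w $ l * ((B *v X k) $ l)\<^sup>2)"
      by (simp add: quadratic_form_K_matrix sum.distrib sum_subtractf sum_distrib_left \<tau>_def flip: Y_def X_def)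
    also have "(\<Sum>k\<in>UNIV. \<Sum>i\<in>UNIV. v $ i * (Y k $ i)\<^sup>2) = (\<Sum>i\<in>UNIV. v $ i * \<alpha> $ i)"
      by (subst sum.swap) (simp add: \<alpha>_def sum_distrib_left)
    also have "(\<Sum>k\<in>UNIV. \<Sum>l\<in>UNIV. w $ l * ((B *v X k) $ l)\<^sup>2) = (\<Sum>l\<in>UNIV. w $ l * \<beta> $ l)"
      by (subst sum.swap) (simp add: \<beta>_def sum_distrib_left)
    finally have *: "(\<Sum>k\<in>UNIV. z k \<bullet> (K_matrix A B v w *v z k)) =
        (\<Sum>i\<in>UNIV. v $ i * \<alpha> $ i) - 2 * \<tau> + (\<Sum>l\<in>UNIV. w $ l * \<beta> $ l)" .
    have "K_matrix A B v w \<in> T" using vw by (auto simp: T_def)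
    from z[OF this] show ?thesis unfolding * by simp
  qed
  have \<alpha>\<beta>: "\<And>i. \<alpha> $ i \<ge> 0" "\<And>l. \<beta> $ l \<ge> 0" by (simp_all add: \<alpha>_def \<beta>_def sum_nonneg)
  obtain v :: "real^'m" where v: "pnorm (conjugate (s / 2)) v \<le> 1" "(\<Sum>i\<in>UNIV. v $ i * \<alpha> $ i) = a"
    using Hoelder_sum_attained[of "s / 2" \<alpha>] \<alpha>\<beta> s by (auto simp: a_def)
  obtain w :: "real^'l" where w: "pnorm (conjugate (p / 2)) w \<le> 1" "(\<Sum>l\<in>UNIV. w $ l * \<beta> $ l) = b"
    using Hoelder_sum_attained[of "p / 2" \<beta>] \<alpha>\<beta> p by (auto simp: b_def)
  have "c *\<^sub>R v \<in> V" "c *\<^sub>R w \<in> W"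
    using v(1) w(1) c p s
    by (auto simp: V_def W_def pnorm_scaleR conjugate_pos mult_left_le)
  from less[OF this] have gap: "c * (a + b) < 2 * \<tau>"
    using v(2) w(2) by (simp add: mult.assoc distrib_left flip: sum_distrib_left)
  \<comment> \<open>rounding is stated for positive bounds, and \<open>a\<close> or \<open>b\<close> may vanish; the gap leaves room for a
      perturbation, and \<open>c + 1\<close> avoids a division by zero\<close>
  define e where "e = (\<tau> - c * (a + b) / 2) / (c + 1)"
  have e: "e > 0" using gap c by (simp add: e_def)
  have "\<tau> \<le> c * sqrt ((a + e) * (b + e))"
    unfolding \<tau>_def c_def using ab e
    by (intro gaussian_rounding inj p s) (auto simp: a_def b_def \<alpha>_def \<beta>_def)
  also have "\<dots> \<le> c * (((a + e) + (b + e)) / 2)"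
    using ab e by (intro mult_left_mono arith_geo_mean_sqrt c) auto
  also have "\<dots> = c * (a + b) / 2 + c * e" by (simp add: field_simps)
  also have "\<dots> < c * (a + b) / 2 + (c + 1) * e" using e by (simp add: distrib_right)
  also have "\<dots> = \<tau>" using c by (simp add: e_def)
  finally show False by simp
qed

text \<open>
  Weak duality. Take \<open>x\<close> where the operator norm is attained and \<open>y\<close> in the unit ball that is extremal
  for \<open>A *v x\<close>, and evaluate the nonnegative quadratic form at \<open>(y, x)\<close>. Each weighted sum of squares is
  at most the norm of the weights, because the vector of squares has norm at most \<open>1\<close> for half
  the exponent.
\<close>

lemma pq_norm_le_dual_objective:
  fixes A :: "real^'n^'m" and B :: "real^'n^'l"
  assumes inj: "inj ((*v) B)" and p: "p \<ge> 2" and s: "s \<ge> 2" and K: "(v, w) \<in> K_set A B"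
  shows "pq_norm (ereal p) (conjugate s) B A
    \<le> 1 / 2 * (pnorm (conjugate (s / 2)) v + pnorm (conjugate (p / 2)) w)"
proof -
  have sq: "pnorm (ereal (r / 2)) (\<chi> i. (u $ i)\<^sup>2) \<le> 1" if "pnorm (ereal r) u \<le> 1" "r \<ge> 2" for u :: "real^'d" and r
  proof -
    have "((u $ i)\<^sup>2) powr (r / 2) = \<bar>u $ i\<bar> powr r" for i
    proof -
      have "((u $ i)\<^sup>2) powr (r / 2) = (\<bar>u $ i\<bar> powr 2) powr (r / 2)" by simp
      then show ?thesis by (simp only: powr_powr) simp
    qed
    then show ?thesis using that pnorm_le_iff[of r 1 u] pnorm_le_iff[of "r / 2" 1 "\<chi> i. (u $ i)\<^sup>2"] by simp
  qed
  obtain x where x: "pnorm (ereal p) (B *v x) \<le> 1"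
      "pnorm (conjugate s) (A *v x) = pq_norm (ereal p) (conjugate s) B A"
    using pq_norm_attained[OF inj, of "ereal p" "conjugate s" A] p s conjugate_pos[of s] by auto
  obtain y :: "real^'m" where y: "pnorm (ereal s) y \<le> 1" "y \<bullet> (A *v x) = pnorm (conjugate s) (A *v x)"
  proof -
    define t where "t = s / (s - 1)"
    have t: "t > 1" "conjugate s = ereal t" "conjugate t = ereal s"
      using s by (auto simp: t_def conjugate_gt_1 field_simps)
    define u where "u = (\<chi> i. \<bar>(A *v x) $ i\<bar>)"
    have "pnorm (ereal t) u = pnorm (ereal t) (A *v x)"
      by (simp add: pnorm_ereal u_def)
    then obtain y' :: "real^'m" where y': "pnorm (ereal s) y' \<le> 1" "(\<Sum>i\<in>UNIV. y' $ i * u $ i) = pnorm (ereal t) (A *v x)"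
      using Hoelder_sum_attained[of t u] t by (auto simp: u_def)
    \<comment> \<open>the extremal vector \<open>y'\<close> belongs to the absolute values; the signs go over to \<open>y\<close>\<close>
    define y where "y = (\<chi> i. if (A *v x) $ i \<ge> 0 then y' $ i else - y' $ i)"
    have "\<bar>y $ i\<bar> = \<bar>y' $ i\<bar>" "y $ i * (A *v x) $ i = y' $ i * u $ i" for i
      by (simp_all add: y_def u_def)
    then show thesis
      using that[of y] y' t by (simp add: pnorm_ereal inner_vec_def)
  qed
  define z :: "real^('m + 'n)" where "z = (\<chi> k. case k of Inl i \<Rightarrow> y $ i | Inr j \<Rightarrow> x $ j)"
  have z: "(\<chi> i. z $ Inl i) = y" "(\<chi> j. z $ Inr j) = x" by (simp_all add: z_def vec_eq_iff)
  have "0 \<le> z \<bullet> (K_matrix A B v w *v z)" using K unfolding in_K_set pos_semidef_def by blast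
  then have "0 \<le> (\<Sum>i\<in>UNIV. v $ i * (y $ i)\<^sup>2) - 2 * (y \<bullet> (A *v x)) + (\<Sum>l\<in>UNIV. w $ l * ((B *v x) $ l)\<^sup>2)"
    unfolding quadratic_form_K_matrix z .
  moreover have "(\<Sum>i\<in>UNIV. v $ i * (y $ i)\<^sup>2) \<le> pnorm (conjugate (s / 2)) v * 1"
    using Hoelder_sum[of "s / 2" v "\<chi> i. (y $ i)\<^sup>2"] s
      mult_left_mono[OF sq[OF y(1) s] pnorm_nonneg[of "conjugate (s / 2)" v]] by simp
  moreover have "(\<Sum>l\<in>UNIV. w $ l * ((B *v x) $ l)\<^sup>2) \<le> pnorm (conjugate (p / 2)) w * 1"
    using Hoelder_sum[of "p / 2" w "\<chi> l. ((B *v x) $ l)\<^sup>2"] p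
      mult_left_mono[OF sq[OF x(1) p] pnorm_nonneg[of "conjugate (p / 2)" w]] by simp
  ultimately show ?thesis using x(2) y(2) by simp
qed

lemma closed_K_set: "closed (K_set A B)"
proof -
  have "K_set A B = (\<lambda>(v, w). K_matrix A B v w) -` {M. pos_semidef M}"
    by (auto simp: in_K_set)
  then show ?thesis
    using closed_vimage[OF closed_pos_semidef continuous_on_K_matrix] by metis
qed

theorem theorem5p4:
  fixes A :: "real^'n^'m" and B :: "real^'n^'l" and p q qs :: real
  assumes "inj ((*v) B)"
    and "1 < q" "q \<le> 2" "2 \<le> p"
    and "1 / q + 1 / qs = 1"
  shows "(\<exists>x\<in>K_set A B. \<forall>y\<in>K_set A B. K_objective p q x \<le> K_objective p q y) \<and>
    pq_norm (ereal p) (ereal q) B A \<le> 1 / 2 * (INF x\<in>K_set A B. K_objective p q x) \<and>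
    1 / 2 * (INF x\<in>K_set A B. K_objective p q x)
      \<le> gamma_const p * gamma_const qs * pq_norm (ereal p) (ereal q) B A"
proof -
  have qs_eq: "qs = q / (q - 1)"
  proof -
    have "qs \<noteq> 0" using assms by auto
    then show ?thesis using assms(2,5) by (simp add: field_simps)
  qed
  have qs: "qs \<ge> 2" "conjugate qs = ereal q"
    using assms(2,3) by (auto simp: qs_eq conjugate_def field_simps)
  have exponents: "ereal q / ereal (2 - q) = conjugate (qs / 2)" "ereal p / ereal (p - 2) = conjugate (p / 2)"
  proof -
    show "ereal q / ereal (2 - q) = conjugate (qs / 2)"
    proof (cases "q = 2")
      case False
      define d where "d = 2 * (q - 1)"
      have d: "d > 0" using assms(2) by (simp add: d_def)
      have half: "qs / 2 = q / d" by (simp add: qs_eq d_def)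
      have "(q - d) / d = q / d - 1" using d by (simp add: diff_divide_distrib)
      moreover have "q - d = 2 - q" by (simp add: d_def)
      ultimately have half_minus_1: "qs / 2 - 1 = (2 - q) / d" by (metis half)
      have "(2 - q) / d > 0" using assms(3) False d by simp
      then have "qs / 2 > 1" using half_minus_1 by linarith
      then have "conjugate (qs / 2) = ereal ((q / d) / ((2 - q) / d))"
        by (simp only: conjugate_gt_1 half_minus_1 flip: half)
      then show ?thesis using False assms(2,3) d by simp
    qed (simp add: qs_eq conjugate_1 exponents_at_2)
    show "ereal p / ereal (p - 2) = conjugate (p / 2)"
      using assms(4) by (cases "p = 2") (auto simp: conjugate_1 conjugate_gt_1 exponents_at_2 field_simps)
  qed
  have obj: "K_objective p q (v, w) = pnorm (conjugate (qs / 2)) v + pnorm (conjugate (p / 2)) w"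
    for v :: "real^'m" and w :: "real^'l"
    by (simp only: K_objective_def prod.case exponents)
  have pos: "conjugate (qs / 2) > 0" "conjugate (p / 2) > 0"
    using qs assms(4) by (auto intro: conjugate_pos)
  define c where "c = gamma_const p * gamma_const qs * pq_norm (ereal p) (ereal q) B A"
  obtain v0 w0 where vw0: "(v0, w0) \<in> K_set A B"
      "pnorm (conjugate (qs / 2)) v0 \<le> c" "pnorm (conjugate (p / 2)) w0 \<le> c"
    using exists_small_dual_feasible[OF assms(1,4) qs(1), of A] by (auto simp: qs(2) c_def)
  \<comment> \<open>outside \<open>S\<close> the objective exceeds \<open>2 * c\<close>, which bounds its value at \<open>(v0, w0)\<close>\<close>
  define S where "S = K_set A B \<inter>
    ({v. pnorm (conjugate (qs / 2)) v \<le> 2 * c} \<times> {w. pnorm (conjugate (p / 2)) w \<le> 2 * c})"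
  have c: "c \<ge> 0" using vw0 pnorm_nonneg order_trans by blast
  have "compact S"
    unfolding S_def using pos by (intro closed_Int_compact closed_K_set compact_Times compact_pnorm_ball)
  moreover have S0: "(v0, w0) \<in> S" using vw0 c by (auto simp: S_def)
  moreover have "continuous_on S (K_objective p q)"
  proof -
    have "continuous_on S (\<lambda>x. pnorm (conjugate (qs / 2)) (fst x) + pnorm (conjugate (p / 2)) (snd x))"
      by (intro continuous_on_add continuous_on_compose2[OF continuous_on_pnorm[where S = UNIV]]
          continuous_on_fst continuous_on_snd continuous_on_id pos) auto
    moreover have "K_objective p q = (\<lambda>x :: (real^'m) \<times> (real^'l). pnorm (conjugate (qs / 2)) (fst x) + pnorm (conjugate (p / 2)) (snd x))"
      using obj by (auto simp: fun_eq_iff)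
    ultimately show ?thesis by simp
  qed
  ultimately obtain x where x: "x \<in> S" "\<And>y. y \<in> S \<Longrightarrow> K_objective p q x \<le> K_objective p q y"
    using continuous_attains_inf[of S "K_objective p q"] by blast
  have x0: "K_objective p q x \<le> 2 * c" using x(2)[OF S0] vw0 by (simp add: obj)
  have min: "K_objective p q x \<le> K_objective p q y" if y: "y \<in> K_set A B" for y
  proof (cases "y \<in> S")
    case False
    obtain v w where "y = (v, w)" by (cases y)
    then have "2 * c \<le> K_objective p q y"
      using False y pnorm_nonneg[of "conjugate (qs / 2)" v] pnorm_nonneg[of "conjugate (p / 2)" w]
      by (auto simp: S_def obj)
    then show ?thesis using x0 by simp
  qed (use x in simp)
  have xK: "x \<in> K_set A B" using x(1) by (simp add: S_def)
  have INF: "(INF x\<in>K_set A B. K_objective p q x) = K_objective p q x"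
    using xK min by (intro cInf_eq_minimum) auto
  obtain v w where vw: "x = (v, w)" by (cases x)
  have "pq_norm (ereal p) (ereal q) B A \<le> 1 / 2 * K_objective p q x"
    using pq_norm_le_dual_objective[OF assms(1,4) qs(1)] xK by (simp add: vw obj qs(2))
  moreover have "\<exists>x\<in>K_set A B. \<forall>y\<in>K_set A B. K_objective p q x \<le> K_objective p q y"
    using xK min by blast
  ultimately show ?thesis using x0 by (simp add: INF c_def)
qed

end
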